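(* Let $\mathbb{F}$ be a field, let $n,k$ be integers with $1<k<n-1$, let $V=\mathbb{F}^n$, and suppose that $|\mathbb{F}|>n-k$. Then the following assertions are fulfilled: (1) If $k\ge 3$, then there is an isomorphism between the graphs $\Gamma_s$ and $\Gamma_k(V)$ whose restriction to $\Delta_k(V)$ is the identity. (2) If $k\le n-3$, then there is an isomorphism between the graphs $\Gamma_t$ and $\Gamma_k(V)$ whose restriction to $\Delta_k(V)$ is the identity.
   Context: For $i\in\{1,\dots,n\}$ let $C_i=\{x\in V: x_i=0\}$. A subspace of $V$ is degenerate if it is contained in some $C_i$, and non-degenerate otherwise. Two $m$-dimensional subspaces are adjacent if their intersection is $(m-1)$-dimensional. $\Gamma_k(V)$ is the simple graph whose vertices are the $k$-dimensional subspaces of $V$ with this adjacency; $\Delta_k(V)$ is its subgraph induced by the non-degenerate $k$-dimensional subspaces. For a $(k-1)$-dimensional subspace $X$, $\mathcal{S}^c(X)$ is the set of non-degenerate $k$-dimensional subspaces containing $X$; for a $(k+1)$-dimensional subspace $Y$, $\mathcal{T}^c(Y)$ is the set of non-degenerate $k$-dimensional subspaces contained in $Y$. $\mathcal{S}^c(X)$ (respectively $\mathcal{T}^c(Y)$) is called a star (respectively a top) of $\Delta_k(V)$ when it is a maximal clique of $\Delta_k(V)$. $\Delta_s$ and $\Delta_t$ are the simple graphs whose vertices are, respectively, the stars and the tops of $\Delta_k(V)$; two distinct vertices $\mathcal{X}_1,\mathcal{X}_2$ of $\Delta_x$, $x\in\{s,t\}$, are adjacent in $\Delta_x$ if and only if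 for each $i\in\{1,2\}$ every element of $\mathcal{X}_i$ is adjacent (in $\Delta_k(V)$) to at least one element of $\mathcal{X}_{3-i}$. $\Delta'_x$ has the same vertex set as $\Delta_x$, and $\mathcal{X}_1,\mathcal{X}_2$ are adjacent in $\Delta'_x$ if and only if they are adjacent in $\Delta_x$ and $\mathcal{X}_1\cap\mathcal{X}_2=\emptyset$. A set of stars is special if it is a maximal clique in both $\Delta_s$ and $\Delta'_s$; a set of tops is special if it is a maximal clique in both $\Delta_t$ and $\Delta'_t$. $\Gamma_s$ (respectively $\Gamma_t$) is the simple graph whose vertices are the non-degenerate $k$-dimensional subspaces together with the special sets of stars (respectively the special sets of tops), with the following edges. Two non-degenerate $k$-dimensional subspaces are joined if and only if they are adjacent. A non-degenerate $k$-dimensional subspace and a special set are joined if and only if the subspace is an element of some star (respectively top) belonging to the special set. Two distinct special sets of stars are adjacent in $\Gamma_s$ if and only if there is a star belonging to both of them. Two distinct special sets of tops $\mathfrak{T}_1,\mathfrak{T}_2$ are adjacent in $\Gamma_t$ if and only if there is a star of $\Delta_k(V)$ which has non-empty intersection with every top belonging to $\mathfrak{T}_i$, for both $i=1$ and $i=2$. *)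

theory Defs
  imports "HOL-Analysis.Analysis"
begin

section \<open>Simple graphs\<close>

text \<open>Only the restriction of the relation to the vertex set is relevant; all notions below
  evaluate it on vertices only. All the relations used below are symmetric and irreflexive there.\<close>

record 'v sgraph =
  vertices :: "'v set"
  adj :: "'v \<Rightarrow> 'v \<Rightarrow> bool"

definition induced_subgraph :: "'v sgraph \<Rightarrow> 'v set \<Rightarrow> 'v sgraph" where
  "induced_subgraph G A = \<lparr>vertices = vertices G \<inter> A, adj = adj G\<rparr>"

definition is_clique :: "'v sgraph \<Rightarrow> 'v set \<Rightarrow> bool" where
  "is_clique G K \<longleftrightarrow> K \<subseteq> vertices G \<and> (\<forall>x\<in>K. \<forall>y\<in>K. x \<noteq> y \<longrightarrow> adj G x y)"

definition is_maximal_clique :: "'v sgraph \<Rightarrow> 'v set \<Rightarrow> bool" where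
  "is_maximal_clique G K \<longleftrightarrow> is_clique G K \<and> (\<forall>L. is_clique G L \<longrightarrow> K \<subseteq> L \<longrightarrow> L = K)"

definition is_graph_isomorphism :: "'v sgraph \<Rightarrow> 'w sgraph \<Rightarrow> ('v \<Rightarrow> 'w) \<Rightarrow> bool" where
  "is_graph_isomorphism G H f \<longleftrightarrow> bij_betw f (vertices G) (vertices H) \<and>
     (\<forall>x\<in>vertices G. \<forall>y\<in>vertices G. adj G x y \<longleftrightarrow> adj H (f x) (f y))"

section \<open>Grassmann graphs and non-degenerate subspaces\<close>

definition subspaces_of_dim :: "nat \<Rightarrow> ('a::field ^ 'n) set set" where
  "subspaces_of_dim m = {U. vec.subspace U \<and> vec.dim U = m}"

definition coord_hyperplane :: "'n \<Rightarrow> ('a::field ^ 'n) set" where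
  "coord_hyperplane i = {x. x $ i = 0}"

definition degenerate :: "('a::field ^ 'n) set \<Rightarrow> bool" where
  "degenerate U \<longleftrightarrow> (\<exists>i. U \<subseteq> coord_hyperplane i)"

text \<open>The condition \<open>dim (U \<inter> W) + 1 = m\<close> avoids truncated subtraction.\<close>

definition Grassmann_graph :: "nat \<Rightarrow> ('a::field ^ 'n) set sgraph" where
  "Grassmann_graph m = \<lparr>vertices = subspaces_of_dim m, adj = (\<lambda>U W. vec.dim (U \<inter> W) + 1 = m)\<rparr>"

definition Delta :: "nat \<Rightarrow> ('a::field ^ 'n) set sgraph" where
  "Delta k = induced_subgraph (Grassmann_graph k) {U. \<not> degenerate U}"

section \<open>Stars and tops\<close>

definition star_c :: "nat \<Rightarrow> ('a::field ^ 'n) set \<Rightarrow> ('a ^ 'n) set set" where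
  "star_c k X = {U \<in> vertices (Delta k). X \<subseteq> U}"

definition top_c :: "nat \<Rightarrow> ('a::field ^ 'n) set \<Rightarrow> ('a ^ 'n) set set" where
  "top_c k Y = {U \<in> vertices (Delta k). U \<subseteq> Y}"

definition stars :: "nat \<Rightarrow> ('a::field ^ 'n) set set set" where
  "stars k = {S. is_maximal_clique (Delta k) S \<and> (\<exists>X \<in> subspaces_of_dim (k - 1). S = star_c k X)}"

definition tops :: "nat \<Rightarrow> ('a::field ^ 'n) set set set" where
  "tops k = {T. is_maximal_clique (Delta k) T \<and> (\<exists>Y \<in> subspaces_of_dim (k + 1). T = top_c k Y)}"

text \<open>For a family \<open>\<M>\<close> of vertex sets of \<^term>\<open>Delta k\<close> (used with \<open>\<M> = stars k\<close> and
  \<open>\<M> = tops k\<close>), the two graphs with vertex set \<open>\<M>\<close>.\<close>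

definition Delta_on ::
  "nat \<Rightarrow> ('a::field ^ 'n) set set set \<Rightarrow> ('a ^ 'n) set set sgraph" where
  "Delta_on k \<M> = \<lparr>vertices = \<M>, adj = (\<lambda>A B. A \<noteq> B \<and>
     (\<forall>U\<in>A. \<exists>W\<in>B. adj (Delta k) U W) \<and> (\<forall>W\<in>B. \<exists>U\<in>A. adj (Delta k) W U))\<rparr>"

definition Delta'_on ::
  "nat \<Rightarrow> ('a::field ^ 'n) set set set \<Rightarrow> ('a ^ 'n) set set sgraph" where
  "Delta'_on k \<M> = \<lparr>vertices = \<M>, adj = (\<lambda>A B. adj (Delta_on k \<M>) A B \<and> A \<inter> B = {})\<rparr>"

definition special_sets ::
  "nat \<Rightarrow> ('a::field ^ 'n) set set set \<Rightarrow> ('a ^ 'n) set set set set" where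
  "special_sets k \<M> =
     {\<SS>. is_maximal_clique (Delta_on k \<M>) \<SS> \<and> is_maximal_clique (Delta'_on k \<M>) \<SS>}"

section \<open>The extended graphs\<close>

text \<open>Vertices are tagged: \<open>Inl U\<close> is a non-degenerate subspace and \<open>Inr \<SS>\<close> is a special set.
  The parameter \<open>R\<close> tells which distinct special sets are joined.\<close>

fun ext_adj :: "nat \<Rightarrow> (('a::field ^ 'n) set set set \<Rightarrow> ('a ^ 'n) set set set \<Rightarrow> bool) \<Rightarrow>
    ('a ^ 'n) set + ('a ^ 'n) set set set \<Rightarrow> ('a ^ 'n) set + ('a ^ 'n) set set set \<Rightarrow> bool" where
  "ext_adj k R (Inl U) (Inl W) \<longleftrightarrow> adj (Delta k) U W"
| "ext_adj k R (Inl U) (Inr \<SS>) \<longleftrightarrow> (\<exists>A\<in>\<SS>. U \<in> A)"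
| "ext_adj k R (Inr \<SS>) (Inl U) \<longleftrightarrow> (\<exists>A\<in>\<SS>. U \<in> A)"
| "ext_adj k R (Inr \<SS>) (Inr \<TT>) \<longleftrightarrow> \<SS> \<noteq> \<TT> \<and> R \<SS> \<TT>"

definition Gamma_s :: "nat \<Rightarrow> (('a::field ^ 'n) set + ('a ^ 'n) set set set) sgraph" where
  "Gamma_s k = \<lparr>vertices = vertices (Delta k) <+> special_sets k (stars k),
     adj = ext_adj k (\<lambda>\<SS>\<^sub>1 \<SS>\<^sub>2. \<exists>S \<in> stars k. S \<in> \<SS>\<^sub>1 \<and> S \<in> \<SS>\<^sub>2)\<rparr>"

definition Gamma_t :: "nat \<Rightarrow> (('a::field ^ 'n) set + ('a ^ 'n) set set set) sgraph" where
  "Gamma_t k = \<lparr>vertices = vertices (Delta k) <+> special_sets k (tops k),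
     adj = ext_adj k (\<lambda>\<TT>\<^sub>1 \<TT>\<^sub>2. \<exists>S \<in> stars k. (\<forall>T\<in>\<TT>\<^sub>1. S \<inter> T \<noteq> {}) \<and> (\<forall>T\<in>\<TT>\<^sub>2. S \<inter> T \<noteq> {}))\<rparr>"

end

theory Submission
  imports Defs
begin

text \<open>
  The special sets are a description, inside the non-degenerate part of the Grassmann graph, of the
  degenerate \<open>k\<close>-dimensional subspaces. Once this is known, both isomorphisms send a special set
  to the subspace that it describes.

  Over a large field every \<open>(k - 1)\<close>-dimensional \<open>X\<close> gives a star \<open>\<S>\<^sup>c(X)\<close>, every non-degenerate
  \<open>(k + 1)\<close>-dimensional \<open>Y\<close> gives a top \<open>\<T>\<^sup>c(Y)\<close>, and these stars and tops determine \<open>X\<close> and \<open>Y\<close>.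
  Moreover, adjacency of stars or tops is adjacency of the subspaces that define them. So \<open>\<Delta>\<^sub>s\<close> is a
  copy of \<open>\<Gamma>\<^bsub>k-1\<^esub>(V)\<close>, and \<open>\<Delta>\<^sub>t\<close> is a copy of \<open>\<Delta>\<^bsub>k+1\<^esub>(V)\<close> (\<open>star_c_isomorphism\<close> and
  \<open>top_c_isomorphism\<close>). A maximal clique of such a graph consists of all its subspaces above a given
  one or of all its subspaces below a given one. Adjacent stars \<open>\<S>\<^sup>c(X\<^sub>1)\<close>, \<open>\<S>\<^sup>c(X\<^sub>2)\<close> meet only in
  \<open>X\<^sub>1 + X\<^sub>2\<close>, so they are disjoint exactly when \<open>X\<^sub>1 + X\<^sub>2\<close> is degenerate; adjacent tops \<open>\<T>\<^sup>c(Y\<^sub>1)\<close>,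
  \<open>\<T>\<^sup>c(Y\<^sub>2)\<close> are disjoint exactly when \<open>Y\<^sub>1 \<inter> Y\<^sub>2\<close> is degenerate. This leaves, as special sets of stars,
  the families of all \<open>\<S>\<^sup>c(X)\<close> with \<open>X \<subseteq> D\<close> and, as special sets of tops, the families of all
  \<open>\<T>\<^sup>c(Y)\<close> with \<open>D \<subseteq> Y\<close>, for \<open>D\<close> degenerate of dimension \<open>k\<close> (\<open>special_sets_stars\<close> and
  \<open>special_sets_tops\<close>).

  The field enters through one counting argument, \<open>exists_nondegenerate_between\<close>. If \<open>A\<close> has
  codimension \<open>2\<close> in a non-degenerate \<open>Y\<close>, at least \<open>|F| + 1\<close> subspaces lie strictly between them. A
  coordinate makes one of these degenerate only if it vanishes on \<open>A\<close>, and then it does so for at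
  most one of them; at most \<open>n - dim A\<close> coordinates vanish on \<open>A\<close>. For \<open>dim A = k - 1\<close> the bound
  \<open>|F| > n - k\<close> leaves a non-degenerate one. It is used in the form of a finite set of
  \<open>n - k + 1\<close> scalars, which treats finite and infinite fields alike.
\<close>

section \<open>Subspaces of a given dimension\<close>

lemma subspaces_of_dimD:
  assumes "U \<in> subspaces_of_dim m"
  shows "vec.subspace U" "vec.dim U = m"
  using assms by (auto simp: subspaces_of_dim_def)

lemma subspaces_of_dim_Int:
  assumes "vec.subspace U" "vec.subspace W"
  shows "U \<inter> W \<in> subspaces_of_dim (vec.dim (U \<inter> W))"
  using assms by (auto simp: subspaces_of_dim_def intro: vec.subspace_inter)

lemma dim_span_Un_plus_dim_Int:
  fixes U W :: "('a::field ^ 'n) set"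
  assumes "vec.subspace U" "vec.subspace W"
  shows "vec.dim (vec.span (U \<union> W)) + vec.dim (U \<inter> W) = vec.dim U + vec.dim W"
proof -
  have "vec.span (U \<union> W) = {x + y |x y. x \<in> U \<and> y \<in> W}"
    using assms by (simp add: vec.span_Un vec.span_eq_iff[THEN iffD2])
  then show ?thesis using vec.dim_sums_Int[OF assms] by simp
qed

lemma span_Un_le_iff:
  assumes "vec.subspace Y"
  shows "vec.span (U \<union> W) \<subseteq> Y \<longleftrightarrow> U \<subseteq> Y \<and> W \<subseteq> Y"
  using assms vec.span_minimal[of "U \<union> W" Y] vec.span_superset[of "U \<union> W"] by auto

lemma subset_span_Un: "U \<subseteq> vec.span (U \<union> W)" "W \<subseteq> vec.span (U \<union> W)"
  using vec.span_superset[of "U \<union> W"] by auto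

lemma subspaces_of_dim_mono:
  assumes "U \<in> subspaces_of_dim l" "W \<in> subspaces_of_dim m" "U \<subseteq> W"
  shows "l \<le> m"
  using assms vec.dim_subset[of U W] by (auto simp: subspaces_of_dim_def)

lemma subspaces_of_dim_eqI:
  assumes "U \<in> subspaces_of_dim l" "W \<in> subspaces_of_dim m" "U \<subseteq> W" "m \<le> l"
  shows "U = W"
  using assms vec.subspace_dim_equal[of U W] by (auto simp: subspaces_of_dim_def)

lemma Int_eq_common_hyperplane:
  assumes "X \<in> subspaces_of_dim m" "U \<in> subspaces_of_dim (Suc m)" "W \<in> subspaces_of_dim (Suc m)"
    and "X \<subseteq> U" "X \<subseteq> W" "U \<noteq> W"
  shows "U \<inter> W = X"
proof -
  note [simp] = subspaces_of_dimD[OF assms(1)] subspaces_of_dimD[OF assms(2)] subspaces_of_dimD[OF assms(3)]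
  have I: "U \<inter> W \<in> subspaces_of_dim (vec.dim (U \<inter> W))"
    by (rule subspaces_of_dim_Int) auto
  have "\<not> Suc m \<le> vec.dim (U \<inter> W)"
    using subspaces_of_dim_eqI[OF I assms(2)] subspaces_of_dim_eqI[OF I assms(3)] assms(6) by auto
  then show ?thesis
    using subspaces_of_dim_eqI[OF assms(1) I] assms by auto
qed

lemma span_Un_eq_common_cover:
  assumes "U \<in> subspaces_of_dim m" "W \<in> subspaces_of_dim m" "Y \<in> subspaces_of_dim (Suc m)"
    and "U \<subseteq> Y" "W \<subseteq> Y" "U \<noteq> W"
  shows "vec.span (U \<union> W) = Y"
proof -
  let ?S = "vec.span (U \<union> W)"
  note [simp] = subspaces_of_dimD[OF assms(1)] subspaces_of_dimD[OF assms(2)] subspaces_of_dimD[OF assms(3)]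
  have S: "?S \<in> subspaces_of_dim (vec.dim ?S)" by (simp add: subspaces_of_dim_def)
  have "\<not> vec.dim ?S \<le> m"
  proof
    assume "vec.dim ?S \<le> m"
    then have "U = ?S" "W = ?S"
      by (rule subspaces_of_dim_eqI[OF assms(1) S subset_span_Un(1)],
          rule subspaces_of_dim_eqI[OF assms(2) S subset_span_Un(2)])
    with assms(6) show False by simp
  qed
  moreover have "?S \<subseteq> Y" using assms span_Un_le_iff[of Y] by simp
  ultimately show ?thesis using subspaces_of_dim_eqI[OF S assms(3)] by auto
qed

lemma adjacent_if_common_cover:
  assumes "U \<in> subspaces_of_dim m" "W \<in> subspaces_of_dim m" "Y \<in> subspaces_of_dim (Suc m)"
    and "U \<subseteq> Y" "W \<subseteq> Y" "U \<noteq> W"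
  shows "vec.dim (U \<inter> W) + 1 = m"
  using dim_span_Un_plus_dim_Int[of U W] span_Un_eq_common_cover[OF assms] assms
  by (simp add: subspaces_of_dim_def)

lemma exists_common_hyperplane_iff:
  assumes "U \<in> subspaces_of_dim (Suc m)" "W \<in> subspaces_of_dim (Suc m)" "U \<noteq> W"
  shows "(\<exists>X \<in> subspaces_of_dim m. X \<subseteq> U \<and> X \<subseteq> W) \<longleftrightarrow> vec.dim (U \<inter> W) + 1 = Suc m"
proof
  assume "\<exists>X \<in> subspaces_of_dim m. X \<subseteq> U \<and> X \<subseteq> W"
  then obtain X where X: "X \<in> subspaces_of_dim m" "X \<subseteq> U" "X \<subseteq> W" by blast
  show "vec.dim (U \<inter> W) + 1 = Suc m"
    using Int_eq_common_hyperplane[OF X(1) assms(1,2) X(2,3) assms(3)] subspaces_of_dimD(2)[OF X(1)]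
    by simp
next
  assume "vec.dim (U \<inter> W) + 1 = Suc m"
  then have "U \<inter> W \<in> subspaces_of_dim m"
    using subspaces_of_dim_Int[OF subspaces_of_dimD(1)[OF assms(1)] subspaces_of_dimD(1)[OF assms(2)]]
    by simp
  then show "\<exists>X \<in> subspaces_of_dim m. X \<subseteq> U \<and> X \<subseteq> W"
    by (rule bexI[rotated]) simp
qed

lemma span_Un_adjacent:
  assumes "U \<in> subspaces_of_dim m" "W \<in> subspaces_of_dim m" "vec.dim (U \<inter> W) + 1 = m"
  shows "vec.span (U \<union> W) \<in> subspaces_of_dim (Suc m)"
  using dim_span_Un_plus_dim_Int[of U W] assms by (simp add: subspaces_of_dim_def)

lemma span_insert_subspaces_of_dim:
  assumes "U \<in> subspaces_of_dim m" "v \<notin> U"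
  shows "vec.span (insert v U) \<in> subspaces_of_dim (Suc m)"
  using assms by (simp add: subspaces_of_dim_def vec.dim_insert vec.span_eq_iff[THEN iffD2])

text \<open>Adjoining a vector outside the span of \<open>U\<close> and \<open>z\<close> keeps \<open>z\<close> outside \<open>U\<close>, and such a vector exists
  in \<open>Y\<close> as long as \<open>U\<close> is not a hyperplane of \<open>Y\<close>.\<close>
lemma exists_between_avoiding_vector:
  assumes "A \<in> subspaces_of_dim l" "Y \<in> subspaces_of_dim m" "A \<subseteq> Y" "z \<notin> A" "l \<le> d" "d < m"
  obtains U where "U \<in> subspaces_of_dim d" "A \<subseteq> U" "U \<subseteq> Y" "z \<notin> U"
proof -
  have "\<exists>U \<in> subspaces_of_dim (l + e). A \<subseteq> U \<and> U \<subseteq> Y \<and> z \<notin> U" if "l + e < m" for e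
    using that
  proof (induction e)
    case 0
    then show ?case using assms by auto
  next
    case (Suc e)
    then obtain U where U: "U \<in> subspaces_of_dim (l + e)" "A \<subseteq> U" "U \<subseteq> Y" "z \<notin> U" by auto
    have "vec.span (insert z U) \<in> subspaces_of_dim (Suc (l + e))"
      using U by (intro span_insert_subspaces_of_dim)
    then have "\<not> Y \<subseteq> vec.span (insert z U)"
      using subspaces_of_dim_mono[OF assms(2)] Suc.prems by fastforce
    then obtain y where y: "y \<in> Y" "y \<notin> vec.span (insert z U)" by auto
    have "y \<notin> U" using y vec.span_superset[of "insert z U"] by auto
    moreover have "z \<notin> vec.span (insert y U)"
      using vec.in_span_insert[of z y U] y(2) U(4) vec.span_eq_iff[THEN iffD2, OF subspaces_of_dimD(1)[OF U(1)]]
      by metis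
    moreover have "vec.span (insert y U) \<subseteq> Y"
      using y U assms(2) by (intro vec.span_minimal) (auto simp: subspaces_of_dim_def)
    moreover have "A \<subseteq> vec.span (insert y U)" using U vec.span_superset[of "insert y U"] by auto
    ultimately show ?case using span_insert_subspaces_of_dim[OF U(1)] by auto
  qed
  from this[of "d - l"] assms that show thesis by auto
qed

lemma exists_between:
  assumes "A \<in> subspaces_of_dim l" "Y \<in> subspaces_of_dim m" "A \<subseteq> Y" "l \<le> d" "d \<le> m"
  obtains U where "U \<in> subspaces_of_dim d" "A \<subseteq> U" "U \<subseteq> Y"
proof (cases "d = m")
  case True
  then show ?thesis using assms that by auto
next
  case False
  then obtain z where "z \<notin> A"
    using subspaces_of_dim_mono[OF assms(2,1)] assms by fastforce
  from exists_between_avoiding_vector[OF assms(1-3) this assms(4)] False assms(5) that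
  show ?thesis by (metis le_neq_implies_less)
qed

lemma UNIV_subspaces_of_dim: "(UNIV :: ('a::field ^ 'n) set) \<in> subspaces_of_dim CARD('n)"
  by (simp add: subspaces_of_dim_def vec_dim_card del: vec.dim_UNIV)

lemma exists_superspace:
  assumes "A \<in> subspaces_of_dim l" "l \<le> d" "d \<le> CARD('n)"
  obtains U :: "('a::field ^ 'n) set" where "U \<in> subspaces_of_dim d" "A \<subseteq> U"
  by (rule exists_between[OF assms(1) UNIV_subspaces_of_dim subset_UNIV assms(2,3)])

lemma zero_subspaces_of_dim: "{0} \<in> subspaces_of_dim 0"
  by (simp add: subspaces_of_dim_def)

lemma exists_subspace_within:
  assumes "Y \<in> subspaces_of_dim m" "d \<le> m"
  obtains U where "U \<in> subspaces_of_dim d" "U \<subseteq> Y"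
  using exists_between[OF zero_subspaces_of_dim assms(1)] assms vec.subspace_0[of Y]
  by (metis empty_subsetI insert_subset le0 subspaces_of_dimD(1))

lemma exists_subspace_omitting:
  assumes A: "A \<in> subspaces_of_dim l" and "0 < l" and Y: "Y \<in> subspaces_of_dim m" and "d < m"
  obtains U where "U \<in> subspaces_of_dim d" "U \<subseteq> Y" "\<not> A \<subseteq> U"
proof -
  have "A \<noteq> {0}" using A \<open>0 < l\<close> by (auto simp: subspaces_of_dim_def)
  then obtain z where z: "z \<in> A" "z \<notin> {0}"
    using vec.subspace_0 subspaces_of_dimD(1)[OF A] by blast
  have "{0} \<subseteq> Y" using vec.subspace_0 subspaces_of_dimD(1)[OF Y] by blast
  from exists_between_avoiding_vector[OF zero_subspaces_of_dim Y this z(2) _ \<open>d < m\<close>] z(1) that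
  show thesis by (metis le0 subsetD)
qed

section \<open>Pencils of subspaces\<close>

text \<open>The quotient of \<open>Y\<close> by \<open>A\<close> is a plane with basis \<open>a\<close>, \<open>b\<close>; its lines include the one through \<open>a\<close> and,
  for each scalar \<open>c\<close> in \<open>T\<close>, the one through \<open>c a + b\<close>.\<close>
lemma pencil_exists:
  fixes A Y :: "('a::field ^ 'n) set" and T :: "'a set"
  assumes A: "A \<in> subspaces_of_dim m" and Y: "Y \<in> subspaces_of_dim (Suc (Suc m))" and "A \<subseteq> Y"
    and "finite T"
  obtains P where "finite P" "card P = Suc (card T)"
    "\<And>U. U \<in> P \<Longrightarrow> U \<in> subspaces_of_dim (Suc m) \<and> A \<subseteq> U \<and> U \<subseteq> Y"
proof -
  obtain a where a: "a \<in> Y" "a \<notin> A"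
    using subspaces_of_dim_mono[OF Y A] by force
  let ?B = "vec.span (insert a A)"
  have B: "?B \<in> subspaces_of_dim (Suc m)" using span_insert_subspaces_of_dim[OF A a(2)] .
  then obtain b where b: "b \<in> Y" "b \<notin> ?B"
    using subspaces_of_dim_mono[OF Y B] by force
  note sA = subspaces_of_dimD(1)[OF A] and sY = subspaces_of_dimD(1)[OF Y]
  define g where "g = (\<lambda>c. case c of None \<Rightarrow> a | Some c \<Rightarrow> c *s a + b)"
  define G where "G = (\<lambda>c. vec.span (insert (g c) A))"
  have gY: "g c \<in> Y" for c
    using a b sY by (auto simp: g_def split: option.split intro: vec.subspace_add vec.subspace_scale)
  have cb: "c *s a + b \<notin> ?B" for c
  proof
    assume "c *s a + b \<in> ?B"
    moreover have "c *s a \<in> ?B" by (simp add: vec.span_base vec.span_scale)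
    ultimately have "c *s a + b - c *s a \<in> ?B" by (rule vec.span_diff)
    then show False using b by simp
  qed
  have gA: "g c \<notin> A" for c
    using a cb vec.span_superset[of "insert a A"] by (auto simp: g_def split: option.split)
  have G: "G c \<in> subspaces_of_dim (Suc m) \<and> A \<subseteq> G c \<and> G c \<subseteq> Y" for c
    unfolding G_def using span_insert_subspaces_of_dim[OF A gA] vec.span_superset[of "insert (g c) A"]
      gY \<open>A \<subseteq> Y\<close> sY vec.span_minimal[of "insert (g c) A" Y] by auto
  have gG: "g c \<in> G c" for c by (simp add: G_def vec.span_base)
  have inj: "inj G"
  proof (rule injI, rule ccontr)
    fix c d assume eq: "G c = G d" and "c \<noteq> d"
    have s: "vec.subspace (G c)" by (simp add: G_def)
    have gc: "g c \<in> G c" "g d \<in> G c" using gG eq by auto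
    have "a \<in> G c"
    proof (cases "c = None \<or> d = None")
      case True
      then show ?thesis using gc by (auto simp: g_def)
    next
      case False
      then obtain x y where xy: "c = Some x" "d = Some y" "x \<noteq> y" using \<open>c \<noteq> d\<close> by auto
      have "g c - g d \<in> G c" using gc s by (intro vec.subspace_diff)
      moreover have "g c - g d = (x - y) *s a"
        by (simp add: xy g_def vec.scale_left_diff_distrib)
      ultimately have "inverse (x - y) *s ((x - y) *s a) \<in> G c" using s by (metis vec.subspace_scale)
      moreover have "inverse (x - y) *s ((x - y) *s a) = a"
        using xy(3) by (subst vector_smult_assoc) simp
      ultimately show ?thesis by simp
    qed
    moreover obtain x where "x *s a + b \<in> G c" using gc \<open>c \<noteq> d\<close> by (cases c; cases d) (auto simp: g_def)
    moreover have "G c = ?B" if "a \<in> G c"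
      using subspaces_of_dim_eqI[OF B conjunct1[OF G[of c]]] that G[of c] s
        vec.span_minimal[of "insert a A" "G c"] by auto
    ultimately show False using cb by auto
  qed
  show thesis
  proof
    show "finite (G ` (insert None (Some ` T)))" using \<open>finite T\<close> by simp
    show "card (G ` (insert None (Some ` T))) = Suc (card T)"
      using \<open>finite T\<close> by (subst card_image[OF inj_on_subset[OF inj subset_UNIV]]) (simp add: card_image)
  qed (use G in auto)
qed

text \<open>Two distinct members of the pencil generate \<open>Y\<close>, so each \<open>H j\<close> contains at most one of them, and
  the pencil has more members than \<open>J\<close> has elements.\<close>
lemma exists_between_avoiding_subspaces:
  fixes A Y :: "('a::field ^ 'n) set" and T :: "'a set"
  assumes A: "A \<in> subspaces_of_dim m" and Y: "Y \<in> subspaces_of_dim (Suc (Suc m))" and "A \<subseteq> Y"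
    and "finite T" and "finite J" "card J \<le> card T"
    and H: "\<And>j. j \<in> J \<Longrightarrow> vec.subspace (H j) \<and> \<not> Y \<subseteq> H j"
  obtains U where "U \<in> subspaces_of_dim (Suc m)" "A \<subseteq> U" "U \<subseteq> Y" "\<And>j. j \<in> J \<Longrightarrow> \<not> U \<subseteq> H j"
proof -
  obtain P where P: "finite P" "card P = Suc (card T)"
    "\<And>U. U \<in> P \<Longrightarrow> U \<in> subspaces_of_dim (Suc m) \<and> A \<subseteq> U \<and> U \<subseteq> Y"
    using pencil_exists[OF A Y \<open>A \<subseteq> Y\<close> \<open>finite T\<close>] by metis
  have "\<exists>U\<in>P. \<forall>j\<in>J. \<not> U \<subseteq> H j"
  proof (rule ccontr)
    assume "\<not> ?thesis"
    then obtain h where h: "\<And>U. U \<in> P \<Longrightarrow> h U \<in> J \<and> U \<subseteq> H (h U)" by metis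
    then have "h ` P \<subseteq> J" by auto
    then have "\<not> inj_on h P"
      using card_inj_on_le[of h P J] P \<open>finite J\<close> \<open>card J \<le> card T\<close> by auto
    then obtain U W where UW: "U \<in> P" "W \<in> P" "U \<noteq> W" "h U = h W" by (auto simp: inj_on_def)
    have "Y = vec.span (U \<union> W)" using span_Un_eq_common_cover[of U "Suc m" W Y] P(3) UW Y by metis
    also have "\<dots> \<subseteq> H (h U)" using h UW H by (metis span_Un_le_iff)
    finally show False using H h UW by blast
  qed
  then show thesis using that P by metis
qed

text \<open>A pencil has at least three members over any field: \<open>T\<close> can be taken to be \<open>{0, 1}\<close>.\<close>
lemma exists_two_between:
  fixes A Y :: "('a::field ^ 'n) set"
  assumes A: "A \<in> subspaces_of_dim m" and Y: "Y \<in> subspaces_of_dim (Suc (Suc m))" and "A \<subseteq> Y"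
    and W: "W \<in> subspaces_of_dim (Suc m)"
  obtains B C where "B \<in> subspaces_of_dim (Suc m)" "A \<subseteq> B" "B \<subseteq> Y"
     "C \<in> subspaces_of_dim (Suc m)" "A \<subseteq> C" "C \<subseteq> Y" "B \<noteq> W" "C \<noteq> W" "B \<noteq> C"
proof -
  obtain P where P: "finite P" "card P = Suc (card {0,1::'a})"
    "\<And>U. U \<in> P \<Longrightarrow> U \<in> subspaces_of_dim (Suc m) \<and> A \<subseteq> U \<and> U \<subseteq> Y"
    using pencil_exists[OF A Y \<open>A \<subseteq> Y\<close>, of "{0,1}"] by (metis finite.intros)
  have "2 \<le> card (P - {W})" using P(1,2) by (simp add: card_Diff_singleton_if)
  then obtain Q where "Q \<subseteq> P - {W}" "card Q = 2" using obtain_subset_with_card_n by metis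
  then obtain B C where "B \<in> P - {W}" "C \<in> P - {W}" "B \<noteq> C" by (auto simp: card_2_iff)
  then show thesis using that[of B C] P(3)[of B] P(3)[of C] by auto
qed

section \<open>Non-degenerate subspaces\<close>

definition vanishing_coords :: "('a::field ^ 'n) set \<Rightarrow> 'n set" where
  "vanishing_coords A = {i. A \<subseteq> coord_hyperplane i}"

lemma subspace_coord_hyperplane: "vec.subspace (coord_hyperplane i)"
  by (auto simp: vec.subspace_def coord_hyperplane_def)

lemma degenerate_mono: "A \<subseteq> U \<Longrightarrow> degenerate U \<Longrightarrow> degenerate A"
  by (auto simp: degenerate_def)

text \<open>The unit vectors of the coordinates that vanish on \<open>A\<close> span a subspace that meets \<open>A\<close> only in
  \<open>0\<close>.\<close>
lemma dim_plus_card_vanishing_coords: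
  fixes A :: "('a::field ^ 'n) set"
  assumes "vec.subspace A"
  shows "vec.dim A + card (vanishing_coords A) \<le> CARD('n)"
proof -
  let ?I = "vanishing_coords A"
  define E :: "('a ^ 'n) set" where "E = (\<lambda>i. axis i 1) ` ?I"
  have "E \<subseteq> cart_basis" by (auto simp: E_def cart_basis_def)
  then have "vec.independent E" using independent_cart_basis vec.independent_mono by blast
  moreover have "card E = card ?I"
    unfolding E_def by (rule card_image) (auto simp: inj_on_def axis_eq_axis)
  ultimately have dimE: "vec.dim (vec.span E) = card ?I"
    by (simp add: vec.dim_eq_card_independent)
  have "vec.span E \<subseteq> {x. \<forall>i. i \<notin> ?I \<longrightarrow> x $ i = 0}"
    by (rule vec.span_minimal) (auto simp: E_def axis_def vec.subspace_def)
  moreover have "A \<subseteq> {x. \<forall>i. i \<in> ?I \<longrightarrow> x $ i = 0}"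
    by (auto simp: vanishing_coords_def coord_hyperplane_def)
  ultimately have "vec.span E \<inter> A \<subseteq> {0}" by (auto simp: vec_eq_iff) blast
  then have "vec.dim (vec.span E \<inter> A) = 0" using vec.dim_eq_0 by blast
  moreover have "vec.dim (vec.span (vec.span E \<union> A)) \<le> CARD('n)" by (rule dim_subset_UNIV_cart_gen)
  ultimately show ?thesis
    using dim_span_Un_plus_dim_Int[of "vec.span E" A] dimE assms vec.subspace_span[of E] by linarith
qed

text \<open>This is where the size of the field matters: only the coordinates in \<open>vanishing_coords A\<close> have to
  be avoided, since the others already fail to vanish on \<open>A\<close>.\<close>
lemma exists_nondegenerate_between:
  fixes A Y :: "('a::field ^ 'n) set" and T :: "'a set"
  assumes A: "A \<in> subspaces_of_dim m" and Y: "Y \<in> subspaces_of_dim (Suc (Suc m))" and "A \<subseteq> Y"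
    and "\<not> degenerate Y" and "finite T" "CARD('n) \<le> m + card T"
  obtains U where "U \<in> subspaces_of_dim (Suc m)" "A \<subseteq> U" "U \<subseteq> Y" "\<not> degenerate U"
proof -
  have "card (vanishing_coords A) \<le> card T"
    using dim_plus_card_vanishing_coords[of A] A assms(6) by (auto simp: subspaces_of_dim_def)
  moreover have "vec.subspace (coord_hyperplane i) \<and> \<not> Y \<subseteq> coord_hyperplane i" for i
    using \<open>\<not> degenerate Y\<close> subspace_coord_hyperplane by (auto simp: degenerate_def)
  ultimately obtain U where U: "U \<in> subspaces_of_dim (Suc m)" "A \<subseteq> U" "U \<subseteq> Y"
      "\<And>i. i \<in> vanishing_coords A \<Longrightarrow> \<not> U \<subseteq> coord_hyperplane i"
    using exists_between_avoiding_subspaces[OF A Y \<open>A \<subseteq> Y\<close> \<open>finite T\<close>,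
        of "vanishing_coords A" coord_hyperplane] by (metis finite)
  then have "\<not> degenerate U" unfolding degenerate_def vanishing_coords_def by blast
  with U that show thesis by blast
qed

text \<open>Either the all-one vector lies outside \<open>P\<close>, or adding \<open>c\<close> times a unit vector outside \<open>P\<close> moves it
  out; \<open>c \<noteq> - 1\<close> keeps the changed entry \<open>1 + c\<close> non-zero.\<close>
lemma exists_nowhere_zero_vector_outside:
  fixes P :: "('a::field ^ 'n) set"
  assumes "vec.subspace P" "P \<noteq> UNIV" and c: "(c::'a) \<noteq> 0" "c \<noteq> - 1"
  obtains v where "v \<notin> P" "\<And>i. v $ i \<noteq> 0"
proof -
  have "\<not> cart_basis \<subseteq> P"
    using vec.span_minimal[of cart_basis P] assms by auto
  then obtain i where i: "axis i 1 \<notin> P" by (auto simp: cart_basis_def)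
  define u :: "'a ^ 'n" where "u = (\<chi> j. 1)"
  show thesis
  proof (cases "u \<in> P")
    case True
    have "u + c *s axis i 1 \<notin> P"
    proof
      assume "u + c *s axis i 1 \<in> P"
      then have "u + c *s axis i 1 - u \<in> P" using True assms by (intro vec.subspace_diff)
      then have "c *s axis i 1 \<in> P" by simp
      then have "inverse c *s (c *s axis i 1) \<in> P" by (rule vec.subspace_scale[OF assms(1)])
      moreover have "inverse c *s (c *s axis i 1) = (axis i 1 :: 'a ^ 'n)"
        using c by (subst vector_smult_assoc) simp
      ultimately show False using i by metis
    qed
    moreover have "(u + c *s axis i 1) $ j \<noteq> 0" for j
      using c by (auto simp: u_def axis_def add_eq_0_iff)
    ultimately show ?thesis using that by blast
  next
    case False
    then show ?thesis using that[of u] by (simp add: u_def)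
  qed
qed

text \<open>Adjoin to \<open>X\<close> a vector without zero entries that lies outside \<open>Y\<close> (or outside \<open>X\<close>, if already \<open>X\<close> is
  not contained in \<open>Y\<close>). This shows that a star does not fit into a top.\<close>
lemma exists_nondegenerate_above_not_within:
  fixes X Y :: "('a::field ^ 'n) set" and T :: "'a set"
  assumes X: "X \<in> subspaces_of_dim m" and Y: "Y \<in> subspaces_of_dim (Suc (Suc m))"
    and "m + 2 < CARD('n)" and "finite T" "2 < card T"
  obtains U where "U \<in> subspaces_of_dim (Suc m)" "X \<subseteq> U" "\<not> U \<subseteq> Y" "\<not> degenerate U"
proof -
  have "card {0, - 1 :: 'a} \<le> 2" by (simp add: card_insert_if)
  then have "\<not> T \<subseteq> {0, - 1}" using card_mono[of "{0, -1}" T] assms(5) by auto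
  then obtain c :: 'a where c: "c \<noteq> 0" "c \<noteq> - 1" by auto
  \<comment> \<open>In both cases a subspace above \<open>X\<close> that contains a vector outside \<open>P\<close> is not within \<open>Y\<close>.\<close>
  define P where "P = (if X \<subseteq> Y then Y else X)"
  have "vec.dim P < CARD('n)" "vec.subspace P"
    using assms by (auto simp: P_def subspaces_of_dim_def)
  then have "P \<noteq> UNIV" using vec_dim_card by (metis less_irrefl)
  then obtain v where v: "v \<notin> P" "\<And>i. v $ i \<noteq> 0"
    using exists_nowhere_zero_vector_outside[OF \<open>vec.subspace P\<close> _ c] by metis
  have vs: "insert v X \<subseteq> vec.span (insert v X)" by (rule vec.span_superset)
  have "v \<notin> X" using v(1) by (auto simp: P_def split: if_splits)
  then have "vec.span (insert v X) \<in> subspaces_of_dim (Suc m)"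
    using span_insert_subspaces_of_dim[OF X] by blast
  moreover have "\<not> vec.span (insert v X) \<subseteq> Y"
    using vs v(1) by (auto simp: P_def split: if_splits)
  moreover have "\<not> degenerate (vec.span (insert v X))"
    using vs v(2) by (auto simp: degenerate_def coord_hyperplane_def)
  ultimately show thesis using that vs by blast
qed

text \<open>This shows that a top does not fit into a star. The counting lemma gives some non-degenerate \<open>U0\<close> in
  \<open>Y\<close>. If \<open>U0\<close> contains \<open>A\<close>, turn it about another hyperplane \<open>D\<close> of \<open>U0\<close>: a different member \<open>U\<close> of the
  pencil between \<open>D\<close> and \<open>Y\<close> satisfies \<open>U \<inter> U0 = D\<close>, so it does not contain \<open>A\<close>. Avoiding also \<open>U0\<close> costs
  one more member of the pencil, so \<open>D\<close> must have one vanishing coordinate fewer than the general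
  bound allows. Of two hyperplanes \<open>B\<close>, \<open>C\<close> of \<open>U0\<close> at least one has this property: no coordinate
  vanishes on both, because \<open>U0 = B + C\<close> is non-degenerate, while all of these coordinates vanish on
  a common subspace of codimension \<open>2\<close> in \<open>U0\<close>.\<close>
lemma exists_nondegenerate_within_not_above:
  fixes A Y :: "('a::field ^ 'n) set" and T :: "'a set"
  assumes A: "A \<in> subspaces_of_dim m" and Y: "Y \<in> subspaces_of_dim (Suc (Suc m))"
    and "\<not> degenerate Y" and "0 < m" "m + 2 < CARD('n)"
    and T: "finite T" "CARD('n) \<le> m + card T"
  obtains U where "U \<in> subspaces_of_dim (Suc m)" "U \<subseteq> Y" "\<not> A \<subseteq> U" "\<not> degenerate U"
proof -
  obtain B0 where "B0 \<in> subspaces_of_dim m" "B0 \<subseteq> Y" using exists_subspace_within[OF Y, of m] by auto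
  then obtain U0 where U0: "U0 \<in> subspaces_of_dim (Suc m)" "U0 \<subseteq> Y" "\<not> degenerate U0"
    using exists_nondegenerate_between[OF _ Y _ \<open>\<not> degenerate Y\<close> T] by metis
  show thesis
  proof (cases "A \<subseteq> U0")
    case False
    then show ?thesis using that U0 by blast
  next
    case True
    obtain l where l: "m = Suc l" using \<open>0 < m\<close> gr0_implies_Suc by blast
    obtain Z where Z: "Z \<in> subspaces_of_dim l" "Z \<subseteq> A"
      using exists_subspace_within[OF A, of l] l by auto
    obtain B C where BC: "B \<in> subspaces_of_dim m" "Z \<subseteq> B" "B \<subseteq> U0"
       "C \<in> subspaces_of_dim m" "Z \<subseteq> C" "C \<subseteq> U0" "B \<noteq> A" "C \<noteq> A" "B \<noteq> C"
      by (rule exists_two_between[OF Z(1) U0(1)[unfolded l] subset_trans[OF Z(2) True] A[unfolded l],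
            folded l])
    have disj: "vanishing_coords B \<inter> vanishing_coords C = {}"
    proof -
      have "vec.span (B \<union> C) = U0" using span_Un_eq_common_cover[OF BC(1,4) U0(1) BC(3,6,9)] .
      then show ?thesis
        using span_Un_le_iff[OF subspace_coord_hyperplane, of B C] U0(3)
        by (auto simp: vanishing_coords_def degenerate_def)
    qed
    have "card (vanishing_coords B) + card (vanishing_coords C) = card (vanishing_coords B \<union> vanishing_coords C)"
      using disj by (simp add: card_Un_disjoint)
    also have "\<dots> \<le> card (vanishing_coords Z)"
      using BC by (intro card_mono) (auto simp: vanishing_coords_def)
    finally have "card (vanishing_coords B) + card (vanishing_coords C) + l \<le> CARD('n)"
      using dim_plus_card_vanishing_coords[of Z] Z(1) by (auto simp: subspaces_of_dim_def)
    then have "card (vanishing_coords B) + m < CARD('n) \<or> card (vanishing_coords C) + m < CARD('n)"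
      using \<open>m + 2 < CARD('n)\<close> l by linarith
    then obtain D where D: "D \<in> subspaces_of_dim m" "D \<subseteq> U0" "D \<noteq> A"
        "card (vanishing_coords D) + m < CARD('n)"
      using BC by blast
    define H where "H = (\<lambda>j. case j of None \<Rightarrow> U0 | Some i \<Rightarrow> coord_hyperplane i)"
    let ?J = "insert None (Some ` vanishing_coords D)"
    have "card ?J \<le> card T" using D(4) T(2) by (simp add: card_image)
    moreover have "vec.subspace (H j) \<and> \<not> Y \<subseteq> H j" for j
      using subspace_coord_hyperplane \<open>\<not> degenerate Y\<close> U0(1) subspaces_of_dim_mono[OF Y U0(1)]
      by (auto simp: H_def degenerate_def subspaces_of_dim_def split: option.split)
    moreover have "D \<subseteq> Y" "finite ?J" using D(2) U0(2) by auto
    ultimately obtain U where U: "U \<in> subspaces_of_dim (Suc m)" "D \<subseteq> U" "U \<subseteq> Y"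
        "\<And>j. j \<in> ?J \<Longrightarrow> \<not> U \<subseteq> H j"
      using exists_between_avoiding_subspaces[OF D(1) Y _ T(1), of ?J H] by metis
    have "\<not> U \<subseteq> U0" using U(4)[of None] by (simp add: H_def)
    moreover have "\<not> degenerate U"
      using U(2) U(4)[of "Some i" for i] by (force simp: H_def degenerate_def vanishing_coords_def)
    moreover have "\<not> A \<subseteq> U"
    proof
      assume "A \<subseteq> U"
      then have "A \<subseteq> D"
        using Int_eq_common_hyperplane[OF D(1) U(1) U0(1) U(2) D(2)] \<open>\<not> U \<subseteq> U0\<close> True by blast
      with subspaces_of_dim_eqI[OF A D(1)] D(3) show False by simp
    qed
    ultimately show ?thesis using that U by blast
  qed
qed

section \<open>Maximal cliques\<close>

lemma vertices_Grassmann_graph [simp]: "vertices (Grassmann_graph m) = subspaces_of_dim m"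
  and adj_Grassmann_graph [simp]: "adj (Grassmann_graph m) U W \<longleftrightarrow> vec.dim (U \<inter> W) + 1 = m"
  by (simp_all add: Grassmann_graph_def)

lemma vertices_induced_subgraph [simp]: "vertices (induced_subgraph G N) = vertices G \<inter> N"
  and adj_induced_subgraph [simp]: "adj (induced_subgraph G N) = adj G"
  by (simp_all add: induced_subgraph_def)

lemma induced_subgraph_UNIV: "induced_subgraph G UNIV = G"
  by (simp add: induced_subgraph_def)

lemma adj_Delta [simp]: "adj (Delta k) U W \<longleftrightarrow> vec.dim (U \<inter> W) + 1 = k"
  by (simp add: Delta_def)

lemma vertices_Delta [simp]: "vertices (Delta k) = {U \<in> subspaces_of_dim k. \<not> degenerate U}"
  by (auto simp: Delta_def)

lemma not_is_maximal_clique_empty: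
  assumes "v \<in> vertices G"
  shows "\<not> is_maximal_clique G {}"
proof
  assume "is_maximal_clique G {}"
  moreover have "is_clique G {v}" using assms by (simp add: is_clique_def)
  ultimately show False by (auto simp: is_maximal_clique_def)
qed

lemma is_graph_isomorphism_inv_into:
  assumes "is_graph_isomorphism G H f"
  shows "is_graph_isomorphism H G (inv_into (vertices G) f)"
  unfolding is_graph_isomorphism_def
proof (intro conjI ballI)
  have f: "bij_betw f (vertices G) (vertices H)" using assms by (simp add: is_graph_isomorphism_def)
  then show b: "bij_betw (inv_into (vertices G) f) (vertices H) (vertices G)"
    by (rule bij_betw_inv_into)
  fix x y assume xy: "x \<in> vertices H" "y \<in> vertices H"
  let ?g = "inv_into (vertices G) f"
  have "?g x \<in> vertices G" "?g y \<in> vertices G" using b xy bij_betw_apply by fast+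
  moreover have "f (?g x) = x" "f (?g y) = y" using f xy bij_betw_inv_into_right by fast+
  ultimately show "adj H x y \<longleftrightarrow> adj G (?g x) (?g y)"
    using assms unfolding is_graph_isomorphism_def by metis
qed

lemma is_clique_image:
  assumes "is_graph_isomorphism G H f" "is_clique G K"
  shows "is_clique H (f ` K)"
proof -
  have f: "f ` vertices G = vertices H"
      "\<And>x y. x \<in> vertices G \<Longrightarrow> y \<in> vertices G \<Longrightarrow> adj G x y \<longleftrightarrow> adj H (f x) (f y)"
    using assms(1) by (auto simp: is_graph_isomorphism_def bij_betw_def)
  have K: "K \<subseteq> vertices G" "\<And>x y. x \<in> K \<Longrightarrow> y \<in> K \<Longrightarrow> x \<noteq> y \<Longrightarrow> adj G x y"
    using assms(2) by (auto simp: is_clique_def)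
  have "adj H (f x) (f y)" if "x \<in> K" "y \<in> K" "f x \<noteq> f y" for x y
    using f(2)[of x y] K that by blast
  then show ?thesis using f(1) K(1) unfolding is_clique_def by blast
qed

lemma is_maximal_clique_image:
  assumes f: "is_graph_isomorphism G H f" and K: "is_maximal_clique G K"
  shows "is_maximal_clique H (f ` K)"
  unfolding is_maximal_clique_def
proof (intro conjI allI impI)
  show "is_clique H (f ` K)" using K is_clique_image[OF f] by (simp add: is_maximal_clique_def)
  fix L assume L: "is_clique H L" "f ` K \<subseteq> L"
  let ?g = "inv_into (vertices G) f"
  have bij: "bij_betw f (vertices G) (vertices H)" using f by (simp add: is_graph_isomorphism_def)
  have sub: "K \<subseteq> vertices G" "L \<subseteq> vertices H"
    using K L by (auto simp: is_maximal_clique_def is_clique_def)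
  have "is_clique G (?g ` L)" by (rule is_clique_image[OF is_graph_isomorphism_inv_into[OF f] L(1)])
  moreover have "?g ` (f ` K) = K"
    using sub bij by (simp add: bij_betw_def inv_into_image_cancel)
  then have "K \<subseteq> ?g ` L" using L(2) by (metis image_mono)
  ultimately have "?g ` L = K" using K by (simp add: is_maximal_clique_def)
  moreover have "f ` (?g ` L) = L"
    using sub bij by (simp add: bij_betw_def image_inv_into_cancel)
  ultimately show "L = f ` K" by simp
qed

lemma is_maximal_clique_image_iff:
  assumes f: "is_graph_isomorphism G H f"
  shows "is_maximal_clique H L \<longleftrightarrow> (\<exists>K. is_maximal_clique G K \<and> L = f ` K)"
proof
  assume L: "is_maximal_clique H L"
  let ?g = "inv_into (vertices G) f"
  have bij: "bij_betw f (vertices G) (vertices H)" using f by (simp add: is_graph_isomorphism_def)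
  have "L \<subseteq> vertices H" using L by (auto simp: is_maximal_clique_def is_clique_def)
  then have "f ` (?g ` L) = L" using bij by (simp add: bij_betw_def image_inv_into_cancel)
  moreover have "is_maximal_clique G (?g ` L)"
    by (rule is_maximal_clique_image[OF is_graph_isomorphism_inv_into[OF f] L])
  ultimately show "\<exists>K. is_maximal_clique G K \<and> L = f ` K" by metis
qed (use is_maximal_clique_image[OF f] in blast)

text \<open>Take distinct \<open>A\<close>, \<open>B\<close> in \<open>K\<close>. If some \<open>C\<close> in \<open>K\<close> does not contain \<open>A \<inter> B\<close>, it meets \<open>A\<close> and \<open>B\<close> in two
  different hyperplanes, so it lies in \<open>A + B\<close>. A further member \<open>D\<close> outside \<open>A + B\<close> would meet \<open>A\<close>, \<open>B\<close>
  and \<open>C\<close> in the same hyperplane \<open>D \<inter> (A + B)\<close>, which would have to be \<open>A \<inter> B\<close>.\<close>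
lemma clique_within_star_or_top:
  fixes K :: "('a::field ^ 'n) set set"
  assumes K: "K \<subseteq> subspaces_of_dim (Suc l)"
    and adj: "\<And>U W. U \<in> K \<Longrightarrow> W \<in> K \<Longrightarrow> U \<noteq> W \<Longrightarrow> vec.dim (U \<inter> W) = l"
    and "l \<le> CARD('n)"
  shows "(\<exists>X \<in> subspaces_of_dim l. \<forall>U\<in>K. X \<subseteq> U) \<or> (\<exists>Y \<in> subspaces_of_dim (Suc (Suc l)). \<forall>U\<in>K. U \<subseteq> Y)"
proof (cases "\<exists>A\<in>K. \<exists>B\<in>K. A \<noteq> B")
  case False
  show ?thesis
  proof (cases "K = {}")
    case True
    then show ?thesis using exists_superspace[OF zero_subspaces_of_dim _ \<open>l \<le> CARD('n)\<close>] by (metis empty_iff le0)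
  next
    case ne: False
    then obtain A where "A \<in> K" by blast
    moreover then obtain X where "X \<in> subspaces_of_dim l" "X \<subseteq> A"
      using K exists_subspace_within[of A "Suc l" l] by auto
    ultimately show ?thesis using False by metis
  qed
next
  case True
  then obtain A B where AB: "A \<in> K" "B \<in> K" "A \<noteq> B" by blast
  have hyp: "U \<inter> W \<in> subspaces_of_dim l" if "U \<in> K" "W \<in> K" "U \<noteq> W" for U W
    using subspaces_of_dim_Int[of U W] adj[OF that] K that subspaces_of_dimD(1) by (metis subsetD)
  let ?Y = "vec.span (A \<union> B)"
  have Y: "?Y \<in> subspaces_of_dim (Suc (Suc l))"
    using span_Un_adjacent[of A "Suc l" B] AB adj[OF AB] K by auto
  show ?thesis
  proof (cases "\<forall>U\<in>K. A \<inter> B \<subseteq> U")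
    case True
    then show ?thesis using hyp[OF AB] by blast
  next
    case False
    then obtain C where C: "C \<in> K" "\<not> A \<inter> B \<subseteq> C" by blast
    then have ne: "C \<noteq> A" "C \<noteq> B" by auto
    have dist: "C \<inter> A \<noteq> C \<inter> B"
    proof
      assume "C \<inter> A = C \<inter> B"
      then have "C \<inter> A \<subseteq> A \<inter> B" by blast
      then have "C \<inter> A = A \<inter> B"
        using subspaces_of_dim_eqI[OF hyp[OF C(1) AB(1) ne(1)] hyp[OF AB]] by simp
      with C(2) show False by blast
    qed
    have "C = vec.span ((C \<inter> A) \<union> (C \<inter> B))"
      using span_Un_eq_common_cover[OF hyp[OF C(1) AB(1) ne(1)] hyp[OF C(1) AB(2) ne(2)] _ _ _ dist] C(1) K
      by blast
    also have "\<dots> \<subseteq> ?Y" by (rule vec.span_mono) blast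
    finally have CY: "C \<subseteq> ?Y" .
    have "D \<subseteq> ?Y" if D: "D \<in> K" for D
    proof (rule ccontr)
      assume nD: "\<not> D \<subseteq> ?Y"
      then have neD: "D \<noteq> A" "D \<noteq> B" "D \<noteq> C" using subset_span_Un CY by blast+
      have DY: "D \<inter> ?Y \<in> subspaces_of_dim (vec.dim (D \<inter> ?Y))"
        using D K by (intro subspaces_of_dim_Int) (auto simp: subspaces_of_dim_def)
      have "vec.dim (D \<inter> ?Y) \<le> l"
      proof (rule ccontr)
        assume "\<not> vec.dim (D \<inter> ?Y) \<le> l"
        then have "D \<inter> ?Y = D" using subspaces_of_dim_eqI[OF DY, of D "Suc l"] D K by auto
        with nD show False by blast
      qed
      then have eq: "D \<inter> E = D \<inter> ?Y" if "E \<in> K" "D \<noteq> E" "E \<subseteq> ?Y" for E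
        using subspaces_of_dim_eqI[OF hyp[OF D that(1,2)] DY] that(3) by blast
      have "D \<inter> A = D \<inter> ?Y" "D \<inter> B = D \<inter> ?Y" "D \<inter> C = D \<inter> ?Y"
        by (rule eq[OF AB(1) neD(1) subset_span_Un(1)], rule eq[OF AB(2) neD(2) subset_span_Un(2)],
            rule eq[OF C(1) neD(3) CY])
      then have "D \<inter> A \<subseteq> A \<inter> B" "D \<inter> A \<subseteq> C" by blast+
      with subspaces_of_dim_eqI[OF hyp[OF D AB(1) neD(1)] hyp[OF AB]] C(2) show False by simp
    qed
    then show ?thesis using Y by blast
  qed
qed

lemma is_clique_star_within:
  assumes "X \<in> subspaces_of_dim l"
  shows "is_clique (induced_subgraph (Grassmann_graph (Suc l)) N)
    {U \<in> vertices (induced_subgraph (Grassmann_graph (Suc l)) N). X \<subseteq> U}"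
  using Int_eq_common_hyperplane[OF assms] subspaces_of_dimD(2)[OF assms] by (auto simp: is_clique_def)

lemma is_clique_top_within:
  assumes "Y \<in> subspaces_of_dim (Suc (Suc l))"
  shows "is_clique (induced_subgraph (Grassmann_graph (Suc l)) N)
    {U \<in> vertices (induced_subgraph (Grassmann_graph (Suc l)) N). U \<subseteq> Y}"
  using adjacent_if_common_cover[OF _ _ assms] by (auto simp: is_clique_def)

lemma is_clique_within_star_or_top:
  fixes K :: "('a::field ^ 'n) set set"
  assumes "is_clique (induced_subgraph (Grassmann_graph (Suc l)) N) K" "l \<le> CARD('n)"
  shows "(\<exists>X \<in> subspaces_of_dim l. \<forall>U\<in>K. X \<subseteq> U) \<or> (\<exists>Y \<in> subspaces_of_dim (Suc (Suc l)). \<forall>U\<in>K. U \<subseteq> Y)"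
  using assms by (intro clique_within_star_or_top) (auto simp: is_clique_def)

lemma is_maximal_clique_star_or_top:
  fixes K N :: "('a::field ^ 'n) set set" and l :: nat
  defines "G \<equiv> induced_subgraph (Grassmann_graph (Suc l)) N"
  assumes K: "is_maximal_clique (G) K" and "l \<le> CARD('n)"
  obtains X where "X \<in> subspaces_of_dim l" "K = {U \<in> vertices (G). X \<subseteq> U}"
  | Y where "Y \<in> subspaces_of_dim (Suc (Suc l))" "K = {U \<in> vertices (G). U \<subseteq> Y}"
proof -
  have sub: "K \<subseteq> vertices (G)" and K': "is_clique (G) K"
    and max: "\<And>L. is_clique (G) L \<Longrightarrow> K \<subseteq> L \<Longrightarrow> L = K"
    using K by (auto simp: is_maximal_clique_def is_clique_def)
  consider X where "X \<in> subspaces_of_dim l" "\<forall>U\<in>K. X \<subseteq> U"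
    | Y where "Y \<in> subspaces_of_dim (Suc (Suc l))" "\<forall>U\<in>K. U \<subseteq> Y"
    using is_clique_within_star_or_top[OF K'[unfolded G_def] \<open>l \<le> CARD('n)\<close>] by blast
  then show thesis
  proof cases
    case 1
    have "{U \<in> vertices G. X \<subseteq> U} = K"
      using 1(2) sub by (intro max[OF is_clique_star_within[OF 1(1), of N, folded G_def]]) auto
    then show ?thesis using that(1)[OF 1(1)] by simp
  next
    case 2
    have "{U \<in> vertices G. U \<subseteq> Y} = K"
      using 2(2) sub by (intro max[OF is_clique_top_within[OF 2(1), of N, folded G_def]]) auto
    then show ?thesis using that(2)[OF 2(1)] by simp
  qed
qed

text \<open>Two members \<open>U\<close>, \<open>W\<close> of the star meet exactly in \<open>X\<close>. The assumption that the star lies in no top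
  provides the second one: apply it to a \<open>Y\<close> above \<open>U\<close>.\<close>
lemma star_determines_center:
  fixes X :: "('a::field ^ 'n) set"
  assumes X: "X \<in> subspaces_of_dim l" and X': "X' \<in> subspaces_of_dim l" and "Suc (Suc l) \<le> CARD('n)"
    and V: "V \<subseteq> subspaces_of_dim (Suc l)"
    and rich: "\<And>Y. Y \<in> subspaces_of_dim (Suc (Suc l)) \<Longrightarrow> \<exists>U \<in> V. X \<subseteq> U \<and> \<not> U \<subseteq> Y"
    and sub: "{U \<in> V. X \<subseteq> U} \<subseteq> {U. X' \<subseteq> U}"
  shows "X = X'"
proof -
  obtain Y0 :: "('a ^ 'n) set" where "Y0 \<in> subspaces_of_dim (Suc (Suc l))"
    by (rule exists_superspace[OF X le_SucI[OF le_SucI[OF order_refl]] assms(3)])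
  then obtain U where U: "U \<in> V" "X \<subseteq> U" using rich by blast
  then have "U \<in> subspaces_of_dim (Suc l)" using V by blast
  then obtain Y where Y: "Y \<in> subspaces_of_dim (Suc (Suc l))" "U \<subseteq> Y"
    by (rule exists_superspace[OF _ le_SucI[OF order_refl] assms(3)])
  obtain W where W: "W \<in> V" "X \<subseteq> W" "\<not> W \<subseteq> Y" using rich[OF Y(1)] by metis
  then have "U \<noteq> W" "W \<in> subspaces_of_dim (Suc l)" using Y V by auto
  then have "U \<inter> W = X"
    using Int_eq_common_hyperplane[OF X \<open>U \<in> subspaces_of_dim (Suc l)\<close> _ U(2) W(2)] by simp
  then have "X' \<subseteq> X" using sub U W by blast
  then show ?thesis using subspaces_of_dim_eqI[OF X' X] by simp
qed

lemma star_is_maximal_clique: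
  fixes X :: "('a::field ^ 'n) set"
  assumes X: "X \<in> subspaces_of_dim l" and n: "Suc (Suc l) \<le> CARD('n)"
    and rich: "\<And>Y. Y \<in> subspaces_of_dim (Suc (Suc l)) \<Longrightarrow>
      \<exists>U \<in> vertices (induced_subgraph (Grassmann_graph (Suc l)) N). X \<subseteq> U \<and> \<not> U \<subseteq> Y"
  shows "is_maximal_clique (induced_subgraph (Grassmann_graph (Suc l)) N)
    {U \<in> vertices (induced_subgraph (Grassmann_graph (Suc l)) N). X \<subseteq> U}"
    (is "is_maximal_clique ?G ?S")
  unfolding is_maximal_clique_def
proof (intro conjI allI impI)
  show "is_clique ?G ?S" by (rule is_clique_star_within[OF X])
  fix L assume L: "is_clique ?G L" "?S \<subseteq> L"
  have "\<not> (\<exists>Y \<in> subspaces_of_dim (Suc (Suc l)). \<forall>U\<in>L. U \<subseteq> Y)" using rich L(2) by fastforce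
  then obtain X' where X': "X' \<in> subspaces_of_dim l" "\<forall>U\<in>L. X' \<subseteq> U"
    using is_clique_within_star_or_top[OF L(1)] n by auto
  then have "X = X'"
    using L(2) by (intro star_determines_center[OF X X'(1) n _ rich]) auto
  then show "L = ?S" using X' L by (auto simp: is_clique_def)
qed

text \<open>Dually, two members of the top generate \<open>Y\<close>; the second one is obtained by applying the assumption
  that the top lies in no star to an \<open>X\<close> inside the first.\<close>
lemma top_determines_cover:
  fixes Y :: "('a::field ^ 'n) set"
  assumes Y: "Y \<in> subspaces_of_dim (Suc (Suc l))" and Y': "Y' \<in> subspaces_of_dim (Suc (Suc l))"
    and V: "V \<subseteq> subspaces_of_dim (Suc l)"
    and rich: "\<And>X. X \<in> subspaces_of_dim l \<Longrightarrow> \<exists>U \<in> V. U \<subseteq> Y \<and> \<not> X \<subseteq> U"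
    and sub: "{U \<in> V. U \<subseteq> Y} \<subseteq> {U. U \<subseteq> Y'}"
  shows "Y = Y'"
proof -
  have "l \<le> Suc (Suc l)" by simp
  then obtain X0 :: "('a ^ 'n) set" where "X0 \<in> subspaces_of_dim l"
    by (rule exists_subspace_within[OF Y])
  then obtain U where U: "U \<in> V" "U \<subseteq> Y" using rich by blast
  then have "U \<in> subspaces_of_dim (Suc l)" using V by blast
  then obtain X where X: "X \<in> subspaces_of_dim l" "X \<subseteq> U"
    by (rule exists_subspace_within[OF _ le_SucI[OF order_refl]])
  obtain W where W: "W \<in> V" "W \<subseteq> Y" "\<not> X \<subseteq> W" using rich[OF X(1)] by metis
  then have "U \<noteq> W" "W \<in> subspaces_of_dim (Suc l)" using X V by auto
  then have "vec.span (U \<union> W) = Y"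
    using span_Un_eq_common_cover[OF \<open>U \<in> subspaces_of_dim (Suc l)\<close> _ Y U(2) W(2)] by simp
  then have "Y \<subseteq> Y'" using sub U W span_Un_le_iff[OF subspaces_of_dimD(1)[OF Y'], of U W] by auto
  then show ?thesis using subspaces_of_dim_eqI[OF Y Y'] by simp
qed

lemma top_is_maximal_clique:
  fixes Y :: "('a::field ^ 'n) set"
  assumes Y: "Y \<in> subspaces_of_dim (Suc (Suc l))" and n: "l \<le> CARD('n)"
    and rich: "\<And>X. X \<in> subspaces_of_dim l \<Longrightarrow>
      \<exists>U \<in> vertices (induced_subgraph (Grassmann_graph (Suc l)) N). U \<subseteq> Y \<and> \<not> X \<subseteq> U"
  shows "is_maximal_clique (induced_subgraph (Grassmann_graph (Suc l)) N)
    {U \<in> vertices (induced_subgraph (Grassmann_graph (Suc l)) N). U \<subseteq> Y}"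
    (is "is_maximal_clique ?G ?S")
  unfolding is_maximal_clique_def
proof (intro conjI allI impI)
  show "is_clique ?G ?S" by (rule is_clique_top_within[OF Y])
  fix L assume L: "is_clique ?G L" "?S \<subseteq> L"
  have "\<not> (\<exists>X \<in> subspaces_of_dim l. \<forall>U\<in>L. X \<subseteq> U)" using rich L(2) by fastforce
  then obtain Y' where Y': "Y' \<in> subspaces_of_dim (Suc (Suc l))" "\<forall>U\<in>L. U \<subseteq> Y'"
    using is_clique_within_star_or_top[OF L(1) n] by auto
  then have "Y = Y'"
    using L(2) by (intro top_determines_cover[OF Y Y'(1) _ rich]) auto
  then show "L = ?S" using Y' L by (auto simp: is_clique_def)
qed

section \<open>The graphs of stars and of tops\<close>

lemma star_c_eq: "star_c k X = {U \<in> vertices (Delta k). X \<subseteq> U}"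
  and top_c_eq: "top_c k Y = {U \<in> vertices (Delta k). U \<subseteq> Y}"
  by (simp_all add: star_c_def top_c_def)

lemma mem_star_c [simp]:
  "U \<in> star_c k X \<longleftrightarrow> U \<in> subspaces_of_dim k \<and> \<not> degenerate U \<and> X \<subseteq> U"
  by (simp add: star_c_def)

lemma mem_top_c [simp]:
  "U \<in> top_c k Y \<longleftrightarrow> U \<in> subspaces_of_dim k \<and> \<not> degenerate U \<and> U \<subseteq> Y"
  by (simp add: top_c_def)

lemma star_c_not_within:
  fixes X Y :: "('a::field ^ 'n) set" and T :: "'a set"
  assumes "X \<in> subspaces_of_dim l" "l + 2 < CARD('n)" "finite T" "2 < card T"
    and "Y \<in> subspaces_of_dim (Suc (Suc l))"
  shows "\<exists>U \<in> star_c (Suc l) X. \<not> U \<subseteq> Y"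
  using exists_nondegenerate_above_not_within[OF assms(1,5,2-4)] by (metis mem_star_c)

lemma star_c_is_maximal_clique:
  fixes X :: "('a::field ^ 'n) set" and T :: "'a set"
  assumes "X \<in> subspaces_of_dim l" "l + 2 < CARD('n)" "finite T" "2 < card T"
  shows "is_maximal_clique (Delta (Suc l)) (star_c (Suc l) X)"
  unfolding star_c_eq
proof (rule star_is_maximal_clique[OF assms(1), where N = "{U. \<not> degenerate U}", folded Delta_def])
  show "\<exists>U\<in>vertices (Delta (Suc l)). X \<subseteq> U \<and> \<not> U \<subseteq> Y" if "Y \<in> subspaces_of_dim (Suc (Suc l))" for Y
    using star_c_not_within[OF assms that] unfolding star_c_eq by blast
qed (use assms(2) in simp)

lemma inj_on_star_c:
  fixes T :: "'a::field set"
  assumes "l + 2 < CARD('n)" "finite T" "2 < card T"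
  shows "inj_on (star_c (Suc l)) (subspaces_of_dim l :: ('a ^ 'n) set set)"
proof (rule inj_onI)
  fix X X' :: "('a ^ 'n) set"
  assume X: "X \<in> subspaces_of_dim l" "X' \<in> subspaces_of_dim l" and eq: "star_c (Suc l) X = star_c (Suc l) X'"
  show "X = X'"
  proof (rule star_determines_center[OF X, where V = "vertices (Delta (Suc l))"])
    show "\<exists>U\<in>vertices (Delta (Suc l)). X \<subseteq> U \<and> \<not> U \<subseteq> Y" if "Y \<in> subspaces_of_dim (Suc (Suc l))" for Y
      using star_c_not_within[OF X(1) assms that] unfolding star_c_eq by blast
    show "{U \<in> vertices (Delta (Suc l)). X \<subseteq> U} \<subseteq> {U. X' \<subseteq> U}"
      using eq unfolding star_c_eq by blast
  qed (use assms in auto)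
qed

lemma top_c_not_above:
  fixes X Y :: "('a::field ^ 'n) set" and T :: "'a set"
  assumes "Y \<in> subspaces_of_dim (Suc (Suc l))" "\<not> degenerate Y" "0 < l" "l + 2 < CARD('n)"
    and "finite T" "CARD('n) \<le> l + card T" and "X \<in> subspaces_of_dim l"
  shows "\<exists>U \<in> top_c (Suc l) Y. \<not> X \<subseteq> U"
  using exists_nondegenerate_within_not_above[OF assms(7,1-6)] by (metis mem_top_c)

lemma top_c_is_maximal_clique:
  fixes Y :: "('a::field ^ 'n) set" and T :: "'a set"
  assumes "Y \<in> subspaces_of_dim (Suc (Suc l))" "\<not> degenerate Y" "0 < l" "l + 2 < CARD('n)"
    and "finite T" "CARD('n) \<le> l + card T"
  shows "is_maximal_clique (Delta (Suc l)) (top_c (Suc l) Y)"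
  unfolding top_c_eq
proof (rule top_is_maximal_clique[OF assms(1), where N = "{U. \<not> degenerate U}", folded Delta_def])
  show "\<exists>U\<in>vertices (Delta (Suc l)). U \<subseteq> Y \<and> \<not> X \<subseteq> U" if "X \<in> subspaces_of_dim l" for X
    using top_c_not_above[OF assms that] unfolding top_c_eq by blast
qed (use assms(4) in simp)

lemma inj_on_top_c:
  fixes T :: "'a::field set"
  assumes "0 < l" "l + 2 < CARD('n)" "finite T" "CARD('n) \<le> l + card T"
  shows "inj_on (top_c (Suc l)) (vertices (Delta (Suc (Suc l))) :: ('a ^ 'n) set set)"
proof (rule inj_onI)
  fix Y Y' :: "('a ^ 'n) set"
  assume "Y \<in> vertices (Delta (Suc (Suc l)))" "Y' \<in> vertices (Delta (Suc (Suc l)))"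
    and eq: "top_c (Suc l) Y = top_c (Suc l) Y'"
  then have Y: "Y \<in> subspaces_of_dim (Suc (Suc l))" "Y' \<in> subspaces_of_dim (Suc (Suc l))"
    and nd: "\<not> degenerate Y" by auto
  show "Y = Y'"
  proof (rule top_determines_cover[OF Y, where V = "vertices (Delta (Suc l))"])
    show "\<exists>U\<in>vertices (Delta (Suc l)). U \<subseteq> Y \<and> \<not> X \<subseteq> U" if "X \<in> subspaces_of_dim l" for X
      using top_c_not_above[OF Y(1) nd assms that] unfolding top_c_eq by blast
    show "{U \<in> vertices (Delta (Suc l)). U \<subseteq> Y} \<subseteq> {U. U \<subseteq> Y'}"
      using eq unfolding top_c_eq by blast
  qed auto
qed

lemma stars_eq:
  fixes T :: "'a::field set"
  assumes "l + 2 < CARD('n)" "finite T" "2 < card T"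
  shows "(stars (Suc l) :: ('a ^ 'n) set set set) = star_c (Suc l) ` subspaces_of_dim l"
proof -
  have "is_maximal_clique (Delta (Suc l)) (star_c (Suc l) X)" if "X \<in> subspaces_of_dim l"
    for X :: "('a ^ 'n) set"
    by (rule star_c_is_maximal_clique[OF that assms])
  then show ?thesis unfolding stars_def by auto
qed

lemma Delta_vertex_exists:
  fixes T :: "'a::field set"
  assumes "l + 2 < CARD('n)" "finite T" "2 < card T"
  obtains U :: "('a ^ 'n) set" where "U \<in> vertices (Delta (Suc l))"
proof -
  have l: "l \<le> CARD('n)" "Suc (Suc l) \<le> CARD('n)" using assms(1) by auto
  obtain X :: "('a ^ 'n) set" where X: "X \<in> subspaces_of_dim l"
    by (rule exists_superspace[OF zero_subspaces_of_dim le0 l(1)])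
  obtain Y :: "('a ^ 'n) set" where Y: "Y \<in> subspaces_of_dim (Suc (Suc l))"
    by (rule exists_superspace[OF zero_subspaces_of_dim le0 l(2)])
  show thesis using star_c_not_within[OF X assms Y] that unfolding star_c_eq by blast
qed

text \<open>A degenerate \<open>Y\<close> contains no non-degenerate subspace, and the empty set is not a maximal clique.\<close>
lemma tops_eq:
  fixes T :: "'a::field set"
  assumes "0 < l" "l + 2 < CARD('n)" "finite T" "2 < card T" "CARD('n) \<le> l + card T"
  shows "(tops (Suc l) :: ('a ^ 'n) set set set) = top_c (Suc l) ` vertices (Delta (Suc (Suc l)))"
proof (intro subset_antisym subsetI)
  fix K :: "('a ^ 'n) set set"
  assume "K \<in> tops (Suc l)"
  then obtain Y where max: "is_maximal_clique (Delta (Suc l)) (top_c (Suc l) Y)"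
    and Y: "Y \<in> subspaces_of_dim (Suc (Suc l))" "K = top_c (Suc l) Y"
    by (auto simp: tops_def)
  obtain U :: "('a ^ 'n) set" where "U \<in> vertices (Delta (Suc l))"
    by (rule Delta_vertex_exists[OF assms(2-4)])
  then have "top_c (Suc l) Y \<noteq> {}" using not_is_maximal_clique_empty max by metis
  then obtain W where "W \<in> top_c (Suc l) Y" by blast
  then have "W \<subseteq> Y" "\<not> degenerate W" by simp_all
  then have "\<not> degenerate Y" using degenerate_mono by blast
  then show "K \<in> top_c (Suc l) ` vertices (Delta (Suc (Suc l)))" using Y by auto
next
  fix K :: "('a ^ 'n) set set"
  assume "K \<in> top_c (Suc l) ` vertices (Delta (Suc (Suc l)))"
  then show "K \<in> tops (Suc l)"
    using top_c_is_maximal_clique[OF _ _ assms(1,2,3,5)] by (auto simp: tops_def)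
qed

text \<open>If \<open>U\<close> does not contain \<open>X2\<close>, then \<open>U + X2\<close> is non-degenerate because \<open>U\<close> is, and \<open>X2\<close> has codimension
  \<open>2\<close> in it; every member of the pencil between them is adjacent to \<open>U\<close>.\<close>
lemma star_step:
  fixes X1 X2 :: "('a::field ^ 'n) set" and T :: "'a set"
  assumes n: "l + 2 < CARD('n)" and T: "finite T" "2 < card T" "CARD('n) \<le> l + card T"
    and X: "X1 \<in> subspaces_of_dim l" "X2 \<in> subspaces_of_dim l" "vec.dim (X1 \<inter> X2) + 1 = l"
    and U: "U \<in> star_c (Suc l) X1"
  shows "\<exists>W \<in> star_c (Suc l) X2. vec.dim (U \<inter> W) = l"
proof -
  have U': "U \<in> subspaces_of_dim (Suc l)" "\<not> degenerate U" "X1 \<subseteq> U" using U by auto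
  show ?thesis
  proof (cases "X2 \<subseteq> U")
    case True
    obtain Y where Y: "Y \<in> subspaces_of_dim (Suc (Suc l))" "U \<subseteq> Y"
      by (rule exists_superspace[OF U'(1), of "Suc (Suc l)"]) (use n in auto)
    obtain W where W: "W \<in> star_c (Suc l) X2" "\<not> W \<subseteq> Y"
      using star_c_not_within[OF X(2) n T(1,2) Y(1)] by blast
    then have "U \<inter> W = X2"
      using Int_eq_common_hyperplane[OF X(2) U'(1), of W] True Y(2) by auto
    then show ?thesis using W X(2) by (auto simp: subspaces_of_dim_def)
  next
    case False
    have sub: "vec.subspace U" "vec.subspace X2" using U'(1) X(2) by (auto simp: subspaces_of_dim_def)
    have I: "U \<inter> X2 \<in> subspaces_of_dim (vec.dim (U \<inter> X2))" by (rule subspaces_of_dim_Int[OF sub])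
    have "vec.dim (X1 \<inter> X2) \<le> vec.dim (U \<inter> X2)" using U'(3) by (intro vec.dim_subset) blast
    moreover have "\<not> l \<le> vec.dim (U \<inter> X2)" using subspaces_of_dim_eqI[OF I X(2)] False by blast
    ultimately have "vec.dim (U \<inter> X2) + 1 = l" using X(3) by linarith
    then have Y: "vec.span (U \<union> X2) \<in> subspaces_of_dim (Suc (Suc l))"
      using dim_span_Un_plus_dim_Int[OF sub] U'(1) X(2) by (simp add: subspaces_of_dim_def)
    have "\<not> degenerate (vec.span (U \<union> X2))"
      using degenerate_mono[OF subset_span_Un(1)] U'(2) by blast
    then obtain W where W: "W \<in> subspaces_of_dim (Suc l)" "X2 \<subseteq> W" "W \<subseteq> vec.span (U \<union> X2)" "\<not> degenerate W"
      using exists_nondegenerate_between[OF X(2) Y subset_span_Un(2) _ T(1,3)] by blast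
    have "vec.dim (U \<inter> W) + 1 = Suc l"
      using adjacent_if_common_cover[OF U'(1) W(1) Y subset_span_Un(1) W(3)] False W(2) by blast
    then show ?thesis using W by auto
  qed
qed

text \<open>If \<open>X1\<close> and \<open>X2\<close> were further apart, a member \<open>U\<close> of the first star with a neighbour above \<open>X2\<close> would
  meet \<open>X2\<close> outside \<open>X1\<close>, so \<open>U \<subseteq> X1 + X2\<close>; then \<open>X1 + X2\<close> has the dimension of a top, and the whole
  star would lie in that top.\<close>
lemma stars_adjacent_imp:
  fixes X1 X2 :: "('a::field ^ 'n) set" and T :: "'a set"
  assumes n: "l + 2 < CARD('n)" and T: "finite T" "2 < card T"
    and X: "X1 \<in> subspaces_of_dim l" "X2 \<in> subspaces_of_dim l" "X1 \<noteq> X2"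
    and adj: "\<forall>U \<in> star_c (Suc l) X1. \<exists>W \<in> star_c (Suc l) X2. vec.dim (U \<inter> W) = l"
  shows "vec.dim (X1 \<inter> X2) + 1 = l"
proof (rule ccontr)
  assume far: "vec.dim (X1 \<inter> X2) + 1 \<noteq> l"
  let ?d = "vec.dim (X1 \<inter> X2)" and ?P = "vec.span (X1 \<union> X2)"
  have sub: "vec.subspace X1" "vec.subspace X2" using X by (auto simp: subspaces_of_dim_def)
  have dims: "vec.dim X1 = l" "vec.dim X2 = l" using X by (auto simp: subspaces_of_dim_def)
  have I: "X1 \<inter> X2 \<in> subspaces_of_dim ?d" by (rule subspaces_of_dim_Int[OF sub])
  have "\<not> l \<le> ?d"
    using subspaces_of_dim_eqI[OF I X(1)] subspaces_of_dim_eqI[OF I X(2)] X(3) by blast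
  with far have d: "?d + 2 \<le> l" by simp
  have dimP: "vec.dim ?P + ?d = 2 * l" using dim_span_Un_plus_dim_Int[OF sub] dims by simp
  have key: "U \<subseteq> ?P \<and> l \<le> ?d + 2" if U: "U \<in> star_c (Suc l) X1" for U
  proof -
    have U': "U \<in> subspaces_of_dim (Suc l)" "X1 \<subseteq> U" using U by auto
    obtain W where W: "W \<in> subspaces_of_dim (Suc l)" "X2 \<subseteq> W" "vec.dim (U \<inter> W) = l"
      using bspec[OF adj U] by auto
    have sUW: "vec.subspace U" "vec.subspace W" "vec.subspace (U \<inter> W)" "vec.subspace (U \<inter> X2)"
      and dU: "vec.dim U = Suc l" "vec.dim W = Suc l"
      using U' W sub by (auto simp: subspaces_of_dim_def intro: vec.subspace_inter)
    have "vec.dim (vec.span (U \<inter> W \<union> X2)) \<le> Suc l"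
      unfolding dU(2)[symmetric] using W(2) sUW(2) span_Un_le_iff by (intro vec.dim_subset) blast
    moreover have "(U \<inter> W) \<inter> X2 = U \<inter> X2" using W(2) by blast
    ultimately have dUX: "l \<le> vec.dim (U \<inter> X2) + 1"
      using dim_span_Un_plus_dim_Int[OF sUW(3) sub(2)] W(3) dims by simp
    have "vec.dim (vec.span (U \<inter> X2 \<union> X1)) \<le> Suc l"
      unfolding dU(1)[symmetric] using U'(2) sUW(1) span_Un_le_iff by (intro vec.dim_subset) blast
    moreover have "(U \<inter> X2) \<inter> X1 = X1 \<inter> X2" using U'(2) by blast
    ultimately have "l \<le> ?d + 2"
      using dim_span_Un_plus_dim_Int[OF sUW(4) sub(1)] dUX dims by simp
    moreover have "\<not> U \<inter> X2 \<subseteq> X1 \<inter> X2"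
      using vec.dim_subset[of "U \<inter> X2" "X1 \<inter> X2"] dUX d by linarith
    then obtain x where x: "x \<in> U" "x \<in> X2" "x \<notin> X1" by blast
    have "vec.span (insert x X1) \<subseteq> U" using x U'(2) sUW(1) by (intro vec.span_minimal) auto
    then have "vec.span (insert x X1) = U"
      using subspaces_of_dim_eqI[OF span_insert_subspaces_of_dim[OF X(1) x(3)] U'(1)] by simp
    then have "U \<subseteq> ?P" using x(2) vec.span_mono[of "insert x X1" "X1 \<union> X2"] by blast
    ultimately show ?thesis by blast
  qed
  obtain Y0 :: "('a ^ 'n) set" where "Y0 \<in> subspaces_of_dim (Suc (Suc l))"
    by (rule exists_superspace[OF X(1), of "Suc (Suc l)"]) (use n in auto)
  then obtain U where "U \<in> star_c (Suc l) X1" using star_c_not_within[OF X(1) n T] by blast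
  then have "?d + 2 = l" using key d by fastforce
  then have "?P \<in> subspaces_of_dim (Suc (Suc l))" using dimP by (simp add: subspaces_of_dim_def)
  then show False using star_c_not_within[OF X(1) n T] key by blast
qed

text \<open>If \<open>U\<close> is not contained in \<open>Y2\<close>, its trace \<open>U \<inter> Y2\<close> has codimension \<open>2\<close> in \<open>Y2\<close>, and every member of the
  pencil between them is adjacent to \<open>U\<close>.\<close>
lemma top_step:
  fixes Y1 Y2 :: "('a::field ^ 'n) set" and T :: "'a set"
  assumes l: "0 < l" and n: "l + 2 < CARD('n)" and T: "finite T" "CARD('n) \<le> l + card T"
    and Y: "Y1 \<in> subspaces_of_dim (Suc (Suc l))" "Y2 \<in> subspaces_of_dim (Suc (Suc l))"
      "vec.dim (Y1 \<inter> Y2) = Suc l" and nd: "\<not> degenerate Y2"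
    and U: "U \<in> top_c (Suc l) Y1"
  shows "\<exists>W \<in> top_c (Suc l) Y2. vec.dim (U \<inter> W) = l"
proof -
  have U': "U \<in> subspaces_of_dim (Suc l)" "\<not> degenerate U" "U \<subseteq> Y1" using U by auto
  obtain A0 where A0: "A0 \<in> subspaces_of_dim l" "A0 \<subseteq> U"
    by (rule exists_subspace_within[OF U'(1) le_SucI[OF order_refl]])
  show ?thesis
  proof (cases "U \<subseteq> Y2")
    case True
    obtain W where W: "W \<in> top_c (Suc l) Y2" "\<not> A0 \<subseteq> W"
      using top_c_not_above[OF Y(2) nd l n T A0(1)] by blast
    then have "vec.dim (U \<inter> W) + 1 = Suc l"
      using adjacent_if_common_cover[OF U'(1) _ Y(2) True, of W] A0 by auto
    then show ?thesis using W by auto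
  next
    case False
    have Z: "Y1 \<inter> Y2 \<in> subspaces_of_dim (Suc l)"
      using subspaces_of_dim_Int[of Y1 Y2] Y by (auto simp: subspaces_of_dim_def)
    have "vec.dim (U \<inter> (Y1 \<inter> Y2)) + 1 = Suc l"
      by (rule adjacent_if_common_cover[OF U'(1) Z Y(1) U'(3)]) (use False in auto)
    moreover have eq: "U \<inter> (Y1 \<inter> Y2) = U \<inter> Y2" using U'(3) by blast
    ultimately have A: "U \<inter> Y2 \<in> subspaces_of_dim l"
      using subspaces_of_dim_Int[of U Y2] U'(1) Y(2) by (auto simp: subspaces_of_dim_def)
    obtain W where W: "W \<in> subspaces_of_dim (Suc l)" "U \<inter> Y2 \<subseteq> W" "W \<subseteq> Y2" "\<not> degenerate W"
      using exists_nondegenerate_between[OF A Y(2) Int_lower2 nd T] by blast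
    have "U \<inter> W = U \<inter> Y2"
      by (rule Int_eq_common_hyperplane[OF A U'(1) W(1) Int_lower1 W(2)]) (use False W(3) in blast)
    then have "vec.dim (U \<inter> W) = l" using A by (simp add: subspaces_of_dim_def)
    moreover have "W \<in> top_c (Suc l) Y2" using W by simp
    ultimately show ?thesis by blast
  qed
qed

text \<open>If \<open>Y1 \<inter> Y2\<close> were smaller, it would coincide with the intersection of any two adjacent members of
  the two tops, so it would be contained in all members of the first top, which would lie in a star.\<close>
lemma tops_adjacent_imp:
  fixes Y1 Y2 :: "('a::field ^ 'n) set" and T :: "'a set"
  assumes l: "0 < l" and n: "l + 2 < CARD('n)" and T: "finite T" "CARD('n) \<le> l + card T"
    and Y: "Y1 \<in> subspaces_of_dim (Suc (Suc l))" "Y2 \<in> subspaces_of_dim (Suc (Suc l))" "Y1 \<noteq> Y2"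
    and nd: "\<not> degenerate Y1"
    and adj: "\<forall>U \<in> top_c (Suc l) Y1. \<exists>W \<in> top_c (Suc l) Y2. vec.dim (U \<inter> W) = l"
  shows "vec.dim (Y1 \<inter> Y2) = Suc l"
proof (rule ccontr)
  assume far: "vec.dim (Y1 \<inter> Y2) \<noteq> Suc l"
  let ?Z = "Y1 \<inter> Y2"
  have Z: "?Z \<in> subspaces_of_dim (vec.dim ?Z)"
    using Y by (intro subspaces_of_dim_Int) (auto simp: subspaces_of_dim_def)
  have "\<not> Suc (Suc l) \<le> vec.dim ?Z"
    using subspaces_of_dim_eqI[OF Z Y(1)] subspaces_of_dim_eqI[OF Z Y(2)] Y(3) by blast
  with far have d: "vec.dim ?Z \<le> l" by simp
  have key: "?Z \<in> subspaces_of_dim l \<and> ?Z \<subseteq> U" if U: "U \<in> top_c (Suc l) Y1" for U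
  proof -
    obtain W where W: "W \<in> top_c (Suc l) Y2" "vec.dim (U \<inter> W) = l" using adj U by blast
    then have "U \<inter> W \<in> subspaces_of_dim l"
      using subspaces_of_dim_Int[of U W] U by (auto simp: subspaces_of_dim_def)
    moreover have "U \<inter> W \<subseteq> ?Z" using U W by auto
    ultimately have "U \<inter> W = ?Z" "vec.dim ?Z = l"
      using subspaces_of_dim_eqI[OF _ Z] d W(2) by metis+
    then show ?thesis using Z by auto
  qed
  have "l \<le> Suc (Suc l)" by simp
  then obtain A0 :: "('a ^ 'n) set" where "A0 \<in> subspaces_of_dim l"
    by (rule exists_subspace_within[OF Y(1)])
  then obtain U where "U \<in> top_c (Suc l) Y1" using top_c_not_above[OF Y(1) nd l n T] by blast
  then have "?Z \<in> subspaces_of_dim l" using key by blast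
  then show False using top_c_not_above[OF Y(1) nd l n T] key by blast
qed

lemma star_c_isomorphism:
  fixes T :: "'a::field set"
  assumes n: "l + 2 < CARD('n)" and T: "finite T" "2 < card T" "CARD('n) \<le> l + card T"
  shows "is_graph_isomorphism (Grassmann_graph l :: ('a ^ 'n) set sgraph)
    (Delta_on (Suc l) (stars (Suc l))) (star_c (Suc l))"
  unfolding is_graph_isomorphism_def
proof (intro conjI ballI)
  have inj: "inj_on (star_c (Suc l)) (subspaces_of_dim l :: ('a ^ 'n) set set)"
    by (rule inj_on_star_c[OF n T(1,2)])
  then show "bij_betw (star_c (Suc l)) (vertices (Grassmann_graph l :: ('a ^ 'n) set sgraph))
      (vertices (Delta_on (Suc l) (stars (Suc l))))"
    by (simp add: bij_betw_def Delta_on_def stars_eq[OF n T(1,2)])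
  fix X1 X2 :: "('a ^ 'n) set"
  assume "X1 \<in> vertices (Grassmann_graph l)" "X2 \<in> vertices (Grassmann_graph l)"
  then have X: "X1 \<in> subspaces_of_dim l" "X2 \<in> subspaces_of_dim l" by simp_all
  have "vec.dim (X1 \<inter> X2) + 1 = l \<longleftrightarrow> X1 \<noteq> X2 \<and>
      (\<forall>U \<in> star_c (Suc l) X1. \<exists>W \<in> star_c (Suc l) X2. vec.dim (U \<inter> W) = l) \<and>
      (\<forall>U \<in> star_c (Suc l) X2. \<exists>W \<in> star_c (Suc l) X1. vec.dim (U \<inter> W) = l)" (is "?L \<longleftrightarrow> ?R")
  proof
    assume L: ?L
    then have L': "vec.dim (X2 \<inter> X1) + 1 = l" by (simp add: Int_commute)
    have "X1 \<noteq> X2" using subspaces_of_dimD(2)[OF X(1)] L by force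
    then show ?R
      by (intro conjI ballI star_step[OF n T X L] star_step[OF n T X(2,1) L'])
  qed (use stars_adjacent_imp[OF n T(1,2) X] in blast)
  moreover have "star_c (Suc l) X1 \<noteq> star_c (Suc l) X2 \<longleftrightarrow> X1 \<noteq> X2" using inj X by (auto dest: inj_onD)
  ultimately show "adj (Grassmann_graph l) X1 X2 \<longleftrightarrow>
      adj (Delta_on (Suc l) (stars (Suc l))) (star_c (Suc l) X1) (star_c (Suc l) X2)"
    by (simp add: Delta_on_def)
qed

lemma top_c_isomorphism:
  fixes T :: "'a::field set"
  assumes l: "0 < l" and n: "l + 2 < CARD('n)" and T: "finite T" "2 < card T" "CARD('n) \<le> l + card T"
  shows "is_graph_isomorphism (Delta (Suc (Suc l)) :: ('a ^ 'n) set sgraph)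
    (Delta_on (Suc l) (tops (Suc l))) (top_c (Suc l))"
  unfolding is_graph_isomorphism_def
proof (intro conjI ballI)
  have inj: "inj_on (top_c (Suc l)) (vertices (Delta (Suc (Suc l))) :: ('a ^ 'n) set set)"
    by (rule inj_on_top_c[OF l n T(1,3)])
  then show "bij_betw (top_c (Suc l)) (vertices (Delta (Suc (Suc l)) :: ('a ^ 'n) set sgraph))
      (vertices (Delta_on (Suc l) (tops (Suc l))))"
    by (simp add: bij_betw_def Delta_on_def tops_eq[OF l n T])
  fix Y1 Y2 :: "('a ^ 'n) set"
  assume Y: "Y1 \<in> vertices (Delta (Suc (Suc l)))" "Y2 \<in> vertices (Delta (Suc (Suc l)))"
  then have Y': "Y1 \<in> subspaces_of_dim (Suc (Suc l))" "Y2 \<in> subspaces_of_dim (Suc (Suc l))"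
    and nd: "\<not> degenerate Y1" "\<not> degenerate Y2" by simp_all
  have "vec.dim (Y1 \<inter> Y2) = Suc l \<longleftrightarrow> Y1 \<noteq> Y2 \<and>
      (\<forall>U \<in> top_c (Suc l) Y1. \<exists>W \<in> top_c (Suc l) Y2. vec.dim (U \<inter> W) = l) \<and>
      (\<forall>U \<in> top_c (Suc l) Y2. \<exists>W \<in> top_c (Suc l) Y1. vec.dim (U \<inter> W) = l)" (is "?L \<longleftrightarrow> ?R")
  proof
    assume L: ?L
    then have L': "vec.dim (Y2 \<inter> Y1) = Suc l" by (simp add: Int_commute)
    have "Y1 \<noteq> Y2" using subspaces_of_dimD(2)[OF Y'(1)] L by force
    then show ?R
      by (intro conjI ballI top_step[OF l n T(1,3) Y' L nd(2)]
            top_step[OF l n T(1,3) Y'(2,1) L' nd(1)])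
  qed (use tops_adjacent_imp[OF l n T(1,3) Y' _ nd(1)] in blast)
  moreover have "top_c (Suc l) Y1 \<noteq> top_c (Suc l) Y2 \<longleftrightarrow> Y1 \<noteq> Y2" using inj Y by (metis inj_onD)
  ultimately show "adj (Delta (Suc (Suc l))) Y1 Y2 \<longleftrightarrow>
      adj (Delta_on (Suc l) (tops (Suc l))) (top_c (Suc l) Y1) (top_c (Suc l) Y2)"
    by (simp add: Delta_on_def)
qed

section \<open>Special sets\<close>

text \<open>Both graphs have the same vertices and the second has fewer edges, so a maximal clique of the first
  is a maximal clique of the second as soon as it is a clique there.\<close>
lemma mem_special_sets_iff:
  fixes \<SS> :: "('a::field ^ 'n) set set set"
  shows
  "\<SS> \<in> special_sets k \<M> \<longleftrightarrow>
    is_maximal_clique (Delta_on k \<M>) \<SS> \<and> (\<forall>A\<in>\<SS>. \<forall>B\<in>\<SS>. A \<noteq> B \<longrightarrow> A \<inter> B = {})"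
proof -
  define disj :: "('a ^ 'n) set set set \<Rightarrow> bool"
    where "disj L \<longleftrightarrow> (\<forall>A\<in>L. \<forall>B\<in>L. A \<noteq> B \<longrightarrow> A \<inter> B = {})" for L
  have clique: "is_clique (Delta'_on k \<M>) L \<longleftrightarrow> is_clique (Delta_on k \<M>) L \<and> disj L" for L
  proof -
    have *: "(\<forall>A\<in>L. \<forall>B\<in>L. A \<noteq> B \<longrightarrow> a A B \<and> d A B) \<longleftrightarrow>
        (\<forall>A\<in>L. \<forall>B\<in>L. A \<noteq> B \<longrightarrow> a A B) \<and> (\<forall>A\<in>L. \<forall>B\<in>L. A \<noteq> B \<longrightarrow> d A B)" for a d
      by (simp only: imp_conjR ball_conj_distrib)
    show ?thesis
      unfolding is_clique_def disj_def conj_assoc *[symmetric] by (simp add: Delta'_on_def Delta_on_def)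
  qed
  show ?thesis
    unfolding special_sets_def is_maximal_clique_def mem_Collect_eq clique disj_def[symmetric] by blast
qed

text \<open>Under the identification with the Grassmann graph, a maximal clique is given either by the subspaces
  above some \<open>Z\<close> or by those inside some \<open>D\<close>. The first kind is never special, since there is a
  non-degenerate \<open>U\<close> above \<open>Z\<close> and two different \<open>X\<close> between \<open>Z\<close> and \<open>U\<close> have \<open>U\<close> in both their stars. The
  second kind is special exactly if \<open>D\<close>, the sum of any two of the subspaces, is degenerate. The
  condition \<open>0 < j\<close>, that is \<open>k \<ge> 3\<close>, makes the subspaces inside \<open>D\<close> a maximal clique: for \<open>j = 0\<close> all
  one-dimensional subspaces are adjacent.\<close>
lemma special_sets_stars:
  fixes T :: "'a::field set"
  assumes l: "l = Suc j" "0 < j" and n: "l + 2 < CARD('n)"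
    and T: "finite T" "2 < card T" "CARD('n) \<le> l + card T"
  shows "(special_sets (Suc l) (stars (Suc l)) :: ('a ^ 'n) set set set set) =
    (\<lambda>D. star_c (Suc l) ` {X \<in> subspaces_of_dim l. X \<subseteq> D}) ` {D \<in> subspaces_of_dim (Suc l). degenerate D}"
    (is "?S = ?\<phi> ` ?D")
proof (intro subset_antisym subsetI)
  note iso = star_c_isomorphism[OF n T]
  fix \<SS> :: "('a ^ 'n) set set set"
  assume "\<SS> \<in> ?S"
  then have max: "is_maximal_clique (Delta_on (Suc l) (stars (Suc l))) \<SS>"
    and disj: "\<And>A B. A \<in> \<SS> \<Longrightarrow> B \<in> \<SS> \<Longrightarrow> A \<noteq> B \<Longrightarrow> A \<inter> B = {}"
    by (auto simp: mem_special_sets_iff)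
  obtain K where K: "is_maximal_clique (Grassmann_graph l) K" "\<SS> = star_c (Suc l) ` K"
    using max is_maximal_clique_image_iff[OF iso] by auto
  \<comment> \<open>Disjointness of the stars forbids two centers in \<open>K\<close> below one non-degenerate \<open>U\<close>.\<close>
  have center_eq: "X = X'" if "X \<in> K" "X' \<in> K" "X \<in> subspaces_of_dim l" "X' \<in> subspaces_of_dim l"
    "X \<subseteq> U" "X' \<subseteq> U" "U \<in> subspaces_of_dim (Suc l)" "\<not> degenerate U" for X X' U
  proof -
    have "U \<in> star_c (Suc l) X \<inter> star_c (Suc l) X'" using that by simp
    then have "star_c (Suc l) X = star_c (Suc l) X'" using disj K(2) that(1,2) by blast
    then show ?thesis using inj_onD[OF inj_on_star_c[OF n T(1,2)]] that(3,4) by blast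
  qed
  have "is_maximal_clique (induced_subgraph (Grassmann_graph (Suc j)) UNIV) K"
    using K(1) by (simp add: induced_subgraph_UNIV l)
  moreover have "j \<le> CARD('n)" using n l by simp
  ultimately consider (star) Z where "Z \<in> subspaces_of_dim j" "K = {X \<in> subspaces_of_dim l. Z \<subseteq> X}"
    | (top) D where "D \<in> subspaces_of_dim (Suc l)" "K = {X \<in> subspaces_of_dim l. X \<subseteq> D}"
    by (rule is_maximal_clique_star_or_top) (simp_all add: l(1))
  then show "\<SS> \<in> ?\<phi> ` ?D"
  proof cases
    case star
    have "j \<le> l" "l \<le> CARD('n)" using n l by simp_all
    then obtain X where X: "X \<in> subspaces_of_dim l" "Z \<subseteq> X"
      by (rule exists_superspace[OF star(1)])
    have "Suc (Suc l) \<le> CARD('n)" using n by simp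
    then obtain Y where Y: "Y \<in> subspaces_of_dim (Suc (Suc l))" "X \<subseteq> Y"
      by (rule exists_superspace[OF X(1) le_SucI[OF le_SucI[OF order_refl]]])
    obtain U where U: "U \<in> star_c (Suc l) X" using star_c_not_within[OF X(1) n T(1,2) Y(1)] by blast
    then have U': "U \<in> subspaces_of_dim (Suc (Suc j))" "\<not> degenerate U" "Z \<subseteq> U"
      using X(2) by (auto simp: l(1))
    obtain B C where "B \<in> subspaces_of_dim l" "Z \<subseteq> B" "B \<subseteq> U"
        "C \<in> subspaces_of_dim l" "Z \<subseteq> C" "C \<subseteq> U" "B \<noteq> C"
      by (rule exists_two_between[OF star(1) U'(1,3) X(1)[unfolded l(1)]]) (simp add: l(1))
    then have False using center_eq[of B C U] U' star(2) by (simp add: l(1))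
    then show ?thesis ..
  next
    case top
    have "degenerate D"
    proof (rule ccontr)
      assume nd: "\<not> degenerate D"
      have "j \<le> Suc (Suc j)" by simp
      then obtain Z where Z: "Z \<in> subspaces_of_dim j" "Z \<subseteq> D"
        by (rule exists_subspace_within[OF top(1)[unfolded l(1)]])
      have "l \<le> CARD('n)" using n by simp
      then obtain W0 :: "('a ^ 'n) set" where W0: "W0 \<in> subspaces_of_dim l"
        by (rule exists_superspace[OF zero_subspaces_of_dim le0])
      obtain B C where "B \<in> subspaces_of_dim l" "B \<subseteq> D" "C \<in> subspaces_of_dim l" "C \<subseteq> D" "B \<noteq> C"
        by (rule exists_two_between[OF Z(1) top(1)[unfolded l(1)] Z(2) W0[unfolded l(1)]]) (simp add: l(1))
      then show False using center_eq[of B C D] nd top by simp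
    qed
    then show ?thesis using top K(2) by blast
  qed
next
  note iso = star_c_isomorphism[OF n T]
  fix \<SS> :: "('a ^ 'n) set set set"
  assume "\<SS> \<in> ?\<phi> ` ?D"
  then obtain D where D: "D \<in> subspaces_of_dim (Suc l)" "degenerate D"
    and \<SS>: "\<SS> = star_c (Suc l) ` {X \<in> subspaces_of_dim l. X \<subseteq> D}" by auto
  have "is_maximal_clique (induced_subgraph (Grassmann_graph (Suc j)) UNIV)
      {X \<in> vertices (induced_subgraph (Grassmann_graph (Suc j)) UNIV). X \<subseteq> D}"
  proof (rule top_is_maximal_clique)
    fix Z :: "('a ^ 'n) set" assume Z: "Z \<in> subspaces_of_dim j"
    have "l < Suc l" by simp
    then obtain X where "X \<in> subspaces_of_dim l" "X \<subseteq> D" "\<not> Z \<subseteq> X"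
      by (rule exists_subspace_omitting[OF Z l(2) D(1)])
    then show "\<exists>X \<in> vertices (induced_subgraph (Grassmann_graph (Suc j)) UNIV). X \<subseteq> D \<and> \<not> Z \<subseteq> X"
      by (auto simp: l(1))
  qed (use D n l in auto)
  then have "is_maximal_clique (Grassmann_graph l) {X \<in> subspaces_of_dim l. X \<subseteq> D}"
    by (simp add: induced_subgraph_UNIV l(1))
  then have "is_maximal_clique (Delta_on (Suc l) (stars (Suc l))) \<SS>"
    unfolding \<SS> by (rule is_maximal_clique_image[OF iso])
  moreover have "A \<inter> B = {}" if AB: "A \<in> \<SS>" "B \<in> \<SS>" "A \<noteq> B" for A B
  proof -
    obtain X X' where X: "X \<in> subspaces_of_dim l" "X \<subseteq> D" "A = star_c (Suc l) X"
      and X': "X' \<in> subspaces_of_dim l" "X' \<subseteq> D" "B = star_c (Suc l) X'"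
      using AB \<SS> by auto
    have ne: "X \<noteq> X'" using AB(3) X(3) X'(3) by blast
    have "\<not> (U \<in> A \<and> U \<in> B)" for U
    proof
      assume "U \<in> A \<and> U \<in> B"
      then have U: "U \<in> subspaces_of_dim (Suc l)" "\<not> degenerate U" "X \<subseteq> U" "X' \<subseteq> U"
        using X(3) X'(3) by auto
      have "U = D"
        using span_Un_eq_common_cover[OF X(1) X'(1) U(1,3,4) ne]
          span_Un_eq_common_cover[OF X(1) X'(1) D(1) X(2) X'(2) ne] by simp
      with U(2) D(2) show False by simp
    qed
    then show ?thesis by blast
  qed
  ultimately show "\<SS> \<in> ?S" by (auto simp: mem_special_sets_iff)
qed

text \<open>Under the identification with the graph of non-degenerate \<open>(k + 1)\<close>-dimensional subspaces, a maximal
  clique is given either by those above some \<open>D\<close> or by those inside some \<open>Q\<close>. The second kind is never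
  special, since \<open>Q\<close> contains a non-degenerate \<open>U\<close> of dimension \<open>k\<close> and two different \<open>Y\<close> between \<open>U\<close> and
  \<open>Q\<close> have \<open>U\<close> in both their tops. The first kind is special exactly if \<open>D\<close>, the intersection of any
  two of the subspaces, is degenerate.\<close>
lemma special_sets_tops:
  fixes T :: "'a::field set"
  assumes l: "0 < l" and n: "l + 3 < CARD('n)"
    and T: "finite T" "2 < card T" "CARD('n) \<le> l + card T"
  shows "(special_sets (Suc l) (tops (Suc l)) :: ('a ^ 'n) set set set set) =
    (\<lambda>D. top_c (Suc l) ` star_c (Suc (Suc l)) D) ` {D \<in> subspaces_of_dim (Suc l). degenerate D}"
    (is "?S = ?\<phi> ` ?D")
proof (intro subset_antisym subsetI)
  have n': "l + 2 < CARD('n)" using n by simp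
  note iso = top_c_isomorphism[OF l n' T]
  fix \<SS> :: "('a ^ 'n) set set set"
  assume "\<SS> \<in> ?S"
  then have max: "is_maximal_clique (Delta_on (Suc l) (tops (Suc l))) \<SS>"
    and disj: "\<And>A B. A \<in> \<SS> \<Longrightarrow> B \<in> \<SS> \<Longrightarrow> A \<noteq> B \<Longrightarrow> A \<inter> B = {}"
    by (auto simp: mem_special_sets_iff)
  obtain K where K: "is_maximal_clique (Delta (Suc (Suc l))) K" "\<SS> = top_c (Suc l) ` K"
    using max is_maximal_clique_image_iff[OF iso] by auto
  \<comment> \<open>Disjointness of the tops forbids two members of \<open>K\<close> above one non-degenerate \<open>U\<close>.\<close>
  have cover_eq: "Y = Y'" if "Y \<in> K" "Y' \<in> K" "Y \<in> vertices (Delta (Suc (Suc l)))"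
    "Y' \<in> vertices (Delta (Suc (Suc l)))"
    "U \<subseteq> Y" "U \<subseteq> Y'" "U \<in> subspaces_of_dim (Suc l)" "\<not> degenerate U" for Y Y' U
  proof -
    have "U \<in> top_c (Suc l) Y \<inter> top_c (Suc l) Y'" using that by simp
    then have "top_c (Suc l) Y = top_c (Suc l) Y'" using disj K(2) that(1,2) by blast
    then show ?thesis using inj_onD[OF inj_on_top_c[OF l n' T(1,3)]] that(3,4) by blast
  qed
  have "Suc l \<le> CARD('n)" using n by simp
  with K(1)[unfolded Delta_def]
  consider (star) D where "D \<in> subspaces_of_dim (Suc l)" "K = star_c (Suc (Suc l)) D"
    | (top) Q where "Q \<in> subspaces_of_dim (Suc (Suc (Suc l)))" "K = top_c (Suc (Suc l)) Q"
    by (rule is_maximal_clique_star_or_top) (simp_all add: star_c_eq top_c_eq Delta_def)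
  then show "\<SS> \<in> ?\<phi> ` ?D"
  proof cases
    case star
    have "degenerate D"
    proof (rule ccontr)
      assume nd: "\<not> degenerate D"
      have "Suc (Suc l) \<le> CARD('n)" "Suc (Suc (Suc l)) \<le> CARD('n)" using n by simp_all
      obtain Q where Q: "Q \<in> subspaces_of_dim (Suc (Suc (Suc l)))" "D \<subseteq> Q"
        by (rule exists_superspace[OF star(1) le_SucI[OF le_SucI[OF order_refl]] \<open>Suc (Suc (Suc l)) \<le> CARD('n)\<close>])
      obtain W0 :: "('a ^ 'n) set" where W0: "W0 \<in> subspaces_of_dim (Suc (Suc l))"
        by (rule exists_superspace[OF zero_subspaces_of_dim le0 \<open>Suc (Suc l) \<le> CARD('n)\<close>])
      obtain B C where BC: "B \<in> subspaces_of_dim (Suc (Suc l))" "D \<subseteq> B"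
          "C \<in> subspaces_of_dim (Suc (Suc l))" "D \<subseteq> C" "B \<noteq> C"
        by (rule exists_two_between[OF star(1) Q W0])
      then have "\<not> degenerate B" "\<not> degenerate C" using nd degenerate_mono by blast+
      with BC show False using cover_eq[of B C D] nd star by simp
    qed
    then show ?thesis using star K(2) by blast
  next
    case top
    have nl: "Suc l + 2 < CARD('n)" using n by simp
    obtain V :: "('a ^ 'n) set" where "V \<in> vertices (Delta (Suc (Suc l)))"
      by (rule Delta_vertex_exists[OF nl T(1,2)])
    then have "K \<noteq> {}" using not_is_maximal_clique_empty K(1) by metis
    then obtain Y where "Y \<in> K" by blast
    then have Y: "Y \<in> subspaces_of_dim (Suc (Suc l))" "Y \<subseteq> Q" "\<not> degenerate Y" using top by auto
    have "l \<le> Suc (Suc l)" by simp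
    then obtain A where "A \<in> subspaces_of_dim l" "A \<subseteq> Y" by (rule exists_subspace_within[OF Y(1)])
    then obtain U where U: "U \<in> subspaces_of_dim (Suc l)" "U \<subseteq> Y" "\<not> degenerate U"
      by (rule exists_nondegenerate_between[OF _ Y(1) _ Y(3) T(1,3)])
    obtain B C where BC: "B \<in> subspaces_of_dim (Suc (Suc l))" "U \<subseteq> B" "B \<subseteq> Q"
        "C \<in> subspaces_of_dim (Suc (Suc l))" "U \<subseteq> C" "C \<subseteq> Q" "B \<noteq> C"
      by (rule exists_two_between[OF U(1) top(1) subset_trans[OF U(2) Y(2)] Y(1)])
    then have "\<not> degenerate B" "\<not> degenerate C" using U(3) degenerate_mono by blast+
    with BC have False using cover_eq[of B C U] U top(2) by simp
    then show ?thesis ..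
  qed
next
  have n': "l + 2 < CARD('n)" and nl: "Suc l + 2 < CARD('n)" using n by simp_all
  note iso = top_c_isomorphism[OF l n' T]
  fix \<SS> :: "('a ^ 'n) set set set"
  assume "\<SS> \<in> ?\<phi> ` ?D"
  then obtain D where D: "D \<in> subspaces_of_dim (Suc l)" "degenerate D"
    and \<SS>: "\<SS> = top_c (Suc l) ` star_c (Suc (Suc l)) D" by auto
  have "is_maximal_clique (Delta_on (Suc l) (tops (Suc l))) \<SS>"
    unfolding \<SS>
    by (rule is_maximal_clique_image[OF iso star_c_is_maximal_clique[OF D(1) nl T(1,2)]])
  moreover have "A \<inter> B = {}" if AB: "A \<in> \<SS>" "B \<in> \<SS>" "A \<noteq> B" for A B
  proof -
    obtain Y Y' where Y: "Y \<in> subspaces_of_dim (Suc (Suc l))" "D \<subseteq> Y" "A = top_c (Suc l) Y"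
      and Y': "Y' \<in> subspaces_of_dim (Suc (Suc l))" "D \<subseteq> Y'" "B = top_c (Suc l) Y'"
      using AB(1,2) by (auto simp: \<SS> elim!: imageE simp del: mem_top_c)
    have ne: "Y \<noteq> Y'" using AB(3) Y(3) Y'(3) by blast
    have "\<not> (U \<in> A \<and> U \<in> B)" for U
    proof
      assume "U \<in> A \<and> U \<in> B"
      then have U: "U \<in> subspaces_of_dim (Suc l)" "\<not> degenerate U" "U \<subseteq> Y" "U \<subseteq> Y'"
        using Y(3) Y'(3) by auto
      have "U = D"
        using Int_eq_common_hyperplane[OF U(1) Y(1) Y'(1) U(3,4) ne]
          Int_eq_common_hyperplane[OF D(1) Y(1) Y'(1) Y(2) Y'(2) ne] by simp
      with U(2) D(2) show False by simp
    qed
    then show ?thesis by blast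
  qed
  ultimately show "\<SS> \<in> ?S" by (auto simp: mem_special_sets_iff)
qed

section \<open>The extended graphs\<close>

text \<open>What remains to be checked for each of the two graphs: \<open>\<phi>\<close> encodes the degenerate subspaces
  bijectively by special sets, and the edges at special sets are the adjacencies of the encoded
  subspaces. The isomorphism is the inverse of \<open>\<phi>\<close> on special sets.\<close>
lemma extended_graph_isomorphism:
  fixes \<phi> :: "('a::field ^ 'n) set \<Rightarrow> ('a ^ 'n) set set set"
  defines "Deg \<equiv> \<lambda>k. {D \<in> subspaces_of_dim k. degenerate D}"
  assumes bij: "bij_betw \<phi> (Deg k) \<A>"
    and mixed: "\<And>U D. U \<in> vertices (Delta k) \<Longrightarrow> D \<in> Deg k \<Longrightarrow>
      (\<exists>A\<in>\<phi> D. U \<in> A) \<longleftrightarrow> vec.dim (U \<inter> D) + 1 = k"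
    and deg: "\<And>D E. D \<in> Deg k \<Longrightarrow> E \<in> Deg k \<Longrightarrow> D \<noteq> E \<Longrightarrow>
      R (\<phi> D) (\<phi> E) \<longleftrightarrow> vec.dim (D \<inter> E) + 1 = k"
  shows "\<exists>f. is_graph_isomorphism \<lparr>vertices = vertices (Delta k) <+> \<A>, adj = ext_adj k R\<rparr>
      (Grassmann_graph k) f \<and> (\<forall>U \<in> vertices (Delta k). f (Inl U) = U)"
proof -
  define G where "G = \<lparr>vertices = vertices (Delta k) <+> \<A>, adj = ext_adj k R\<rparr>"
  define g where "g = (\<lambda>U. if degenerate U then Inr (\<phi> U) else Inl U)"
  have split: "subspaces_of_dim k = vertices (Delta k) \<union> Deg k" by (auto simp: Deg_def)
  have inj: "inj_on \<phi> (Deg k)" and img: "\<phi> ` Deg k = \<A>" using bij by (auto simp: bij_betw_def)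
  have gU: "g U = Inl U" if "U \<in> vertices (Delta k)" for U using that by (simp add: g_def)
  have gD: "g D = Inr (\<phi> D)" if "D \<in> Deg k" for D using that by (simp add: g_def Deg_def)
  have "inj_on g (subspaces_of_dim k)"
  proof (rule inj_onI)
    fix U W assume "U \<in> subspaces_of_dim k" "W \<in> subspaces_of_dim k" "g U = g W"
    then show "U = W"
      using inj_onD[OF inj, of U W] by (auto simp: g_def Deg_def split: if_splits)
  qed
  moreover have "g ` subspaces_of_dim k = vertices G"
    unfolding split image_Un G_def using img by (force simp: gU gD Plus_def)
  ultimately have bijg: "bij_betw g (subspaces_of_dim k) (vertices G)" by (simp add: bij_betw_def)
  have "adj (Grassmann_graph k) U W \<longleftrightarrow> adj G (g U) (g W)"
    if "U \<in> subspaces_of_dim k" "W \<in> subspaces_of_dim k" for U W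
  proof -
    consider "U \<in> vertices (Delta k)" "W \<in> vertices (Delta k)" | "U \<in> vertices (Delta k)" "W \<in> Deg k"
      | "U \<in> Deg k" "W \<in> vertices (Delta k)" | "U \<in> Deg k" "W \<in> Deg k" "U \<noteq> W"
      | "U \<in> Deg k" "U = W"
      using \<open>U \<in> subspaces_of_dim k\<close> \<open>W \<in> subspaces_of_dim k\<close> unfolding split by blast
    then show ?thesis
    proof cases
      case 1
      then show ?thesis by (simp add: gU G_def del: vertices_Delta)
    next
      case 2
      then show ?thesis using mixed[OF 2] by (simp add: gU gD G_def del: vertices_Delta)
    next
      case 3
      then show ?thesis using mixed[OF 3(2,1)]
        by (simp add: gU gD G_def Int_commute del: vertices_Delta)
    next
      case 4
      have "\<phi> U \<noteq> \<phi> W" using inj_onD[OF inj] 4 by blast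
      then show ?thesis using deg[OF 4] 4 by (simp add: gD G_def)
    next
      case 5
      then show ?thesis using that(1) by (simp add: gD G_def subspaces_of_dimD(2))
    qed
  qed
  then have iso: "is_graph_isomorphism (Grassmann_graph k) G g"
    using bijg by (simp add: is_graph_isomorphism_def)
  have "inv_into (subspaces_of_dim k) g (Inl U) = U" if "U \<in> vertices (Delta k)" for U
    using inv_into_f_f[OF bij_betw_imp_inj_on[OF bijg], of U] that gU[OF that] by simp
  moreover have "is_graph_isomorphism G (Grassmann_graph k) (inv_into (subspaces_of_dim k) g)"
    using is_graph_isomorphism_inv_into[OF iso] by simp
  ultimately show ?thesis unfolding G_def by blast
qed

lemma Gamma_s_isomorphism:
  fixes T :: "'a::field set"
  assumes l: "l = Suc j" "0 < j" and n: "l + 2 < CARD('n)"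
    and T: "finite T" "2 < card T" "CARD('n) \<le> l + card T"
  shows "\<exists>f. is_graph_isomorphism (Gamma_s (Suc l)) (Grassmann_graph (Suc l) :: ('a ^ 'n) set sgraph) f \<and>
    (\<forall>U \<in> vertices (Delta (Suc l)). f (Inl U) = U)"
  unfolding Gamma_s_def
proof (rule extended_graph_isomorphism)
  let ?\<phi> = "\<lambda>D. star_c (Suc l) ` {X \<in> subspaces_of_dim l. X \<subseteq> D} :: ('a ^ 'n) set set set"
  let ?D = "{D \<in> subspaces_of_dim (Suc l). degenerate D} :: ('a ^ 'n) set set"
  have inj: "inj_on (star_c (Suc l)) (subspaces_of_dim l :: ('a ^ 'n) set set)"
    by (rule inj_on_star_c[OF n T(1,2)])
  have "inj_on ?\<phi> ?D"
  proof (rule inj_onI)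
    fix D E assume DE: "D \<in> ?D" "E \<in> ?D" and eq: "?\<phi> D = ?\<phi> E"
    have "{X \<in> subspaces_of_dim l. X \<subseteq> D} = {X \<in> subspaces_of_dim l. X \<subseteq> E}"
      by (rule iffD1[OF inj_on_image_eq_iff[OF inj] eq]) auto
    then have sub: "{X \<in> subspaces_of_dim l. X \<subseteq> D} \<subseteq> {X. X \<subseteq> E}" by blast
    have D: "D \<in> subspaces_of_dim (Suc (Suc j))" and E: "E \<in> subspaces_of_dim (Suc (Suc j))"
      using DE by (auto simp: l(1))
    show "D = E"
    proof (rule top_determines_cover[OF D E _ _ sub])
      fix Z :: "('a ^ 'n) set" assume Z: "Z \<in> subspaces_of_dim j"
      have "l < Suc (Suc j)" by (simp add: l(1))
      then obtain X where "X \<in> subspaces_of_dim l" "X \<subseteq> D" "\<not> Z \<subseteq> X"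
        by (rule exists_subspace_omitting[OF Z l(2) D])
      then show "\<exists>X \<in> subspaces_of_dim l. X \<subseteq> D \<and> \<not> Z \<subseteq> X" by blast
    qed (simp add: l(1))
  qed
  then show "bij_betw ?\<phi> ?D (special_sets (Suc l) (stars (Suc l)))"
    unfolding special_sets_stars[OF l n T] by (rule inj_on_imp_bij_betw)
  show "(\<exists>A\<in>?\<phi> D. U \<in> A) \<longleftrightarrow> vec.dim (U \<inter> D) + 1 = Suc l"
    if "U \<in> vertices (Delta (Suc l))" "D \<in> ?D" for U D
  proof -
    have U: "U \<in> subspaces_of_dim (Suc l)" "\<not> degenerate U" "D \<in> subspaces_of_dim (Suc l)" "U \<noteq> D"
      using that by auto
    have "(\<exists>A\<in>?\<phi> D. U \<in> A) \<longleftrightarrow> (\<exists>X \<in> subspaces_of_dim l. X \<subseteq> U \<and> X \<subseteq> D)"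
      using U(1,2) by auto
    then show ?thesis using exists_common_hyperplane_iff[OF U(1,3,4)] by simp
  qed
  show "(\<exists>S \<in> stars (Suc l). S \<in> ?\<phi> D \<and> S \<in> ?\<phi> E) \<longleftrightarrow> vec.dim (D \<inter> E) + 1 = Suc l"
    if "D \<in> ?D" "E \<in> ?D" "D \<noteq> E" for D E
  proof -
    have DE: "D \<in> subspaces_of_dim (Suc l)" "E \<in> subspaces_of_dim (Suc l)" using that by auto
    have "(\<exists>S \<in> stars (Suc l). S \<in> ?\<phi> D \<and> S \<in> ?\<phi> E) \<longleftrightarrow> (\<exists>X \<in> subspaces_of_dim l. X \<subseteq> D \<and> X \<subseteq> E)"
      (is "?L \<longleftrightarrow> ?R")
    proof
      assume ?L
      then obtain X X' where X: "X \<in> subspaces_of_dim l" "X \<subseteq> D" "X' \<in> subspaces_of_dim l" "X' \<subseteq> E"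
        "star_c (Suc l) X = star_c (Suc l) X'" by auto
      then have "X = X'" using inj_onD[OF inj] by blast
      with X show ?R by blast
    next
      assume ?R
      then show ?L unfolding stars_eq[OF n T(1,2)] by blast
    qed
    then show ?thesis using exists_common_hyperplane_iff[OF DE that(3)] by simp
  qed
qed

lemma Gamma_t_isomorphism:
  fixes T :: "'a::field set"
  assumes l: "0 < l" and n: "l + 3 < CARD('n)"
    and T: "finite T" "2 < card T" "CARD('n) \<le> l + card T"
  shows "\<exists>f. is_graph_isomorphism (Gamma_t (Suc l)) (Grassmann_graph (Suc l) :: ('a ^ 'n) set sgraph) f \<and>
    (\<forall>U \<in> vertices (Delta (Suc l)). f (Inl U) = U)"
  unfolding Gamma_t_def
proof (rule extended_graph_isomorphism)
  let ?\<phi> = "\<lambda>D. top_c (Suc l) ` star_c (Suc (Suc l)) D :: ('a ^ 'n) set set set"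
  let ?D = "{D \<in> subspaces_of_dim (Suc l). degenerate D} :: ('a ^ 'n) set set"
  have n': "l + 2 < CARD('n)" and nl: "Suc l + 2 < CARD('n)" using n by simp_all
  have inj: "inj_on (star_c (Suc (Suc l))) (subspaces_of_dim (Suc l) :: ('a ^ 'n) set set)"
    by (rule inj_on_star_c[OF nl T(1,2)])
  have injt: "inj_on (top_c (Suc l)) (vertices (Delta (Suc (Suc l))) :: ('a ^ 'n) set set)"
    by (rule inj_on_top_c[OF l n' T(1,3)])
  have sub: "star_c (Suc (Suc l)) D \<subseteq> vertices (Delta (Suc (Suc l)))" for D :: "('a ^ 'n) set" by auto
  have "inj_on ?\<phi> ?D"
  proof (rule inj_onI)
    fix D E assume DE: "D \<in> ?D" "E \<in> ?D" and eq: "?\<phi> D = ?\<phi> E"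
    have "star_c (Suc (Suc l)) D = star_c (Suc (Suc l)) E"
      by (rule iffD1[OF inj_on_image_eq_iff[OF injt sub sub] eq])
    then show "D = E" using inj_onD[OF inj] DE by blast
  qed
  then show "bij_betw ?\<phi> ?D (special_sets (Suc l) (tops (Suc l)))"
    unfolding special_sets_tops[OF l n T] by (rule inj_on_imp_bij_betw)
  show "(\<exists>A\<in>?\<phi> D. U \<in> A) \<longleftrightarrow> vec.dim (U \<inter> D) + 1 = Suc l" (is "?L \<longleftrightarrow> ?R")
    if "U \<in> vertices (Delta (Suc l))" "D \<in> ?D" for U D
  proof -
    have U: "U \<in> subspaces_of_dim (Suc l)" "\<not> degenerate U" "D \<in> subspaces_of_dim (Suc l)" "U \<noteq> D"
      using that by auto
    show ?thesis
    proof
      assume ?L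
      then obtain Y where Y: "Y \<in> subspaces_of_dim (Suc (Suc l))" "D \<subseteq> Y" "U \<subseteq> Y" by auto
      show ?R by (rule adjacent_if_common_cover[OF U(1,3) Y(1,3,2) U(4)])
    next
      assume ?R
      then have "vec.span (U \<union> D) \<in> subspaces_of_dim (Suc (Suc l))"
        by (rule span_Un_adjacent[OF U(1,3)])
      moreover have "\<not> degenerate (vec.span (U \<union> D))"
        using degenerate_mono[OF subset_span_Un(1)] U(2) by blast
      ultimately have "vec.span (U \<union> D) \<in> star_c (Suc (Suc l)) D" using subset_span_Un by simp
      moreover have "U \<in> top_c (Suc l) (vec.span (U \<union> D))" using U subset_span_Un by simp
      ultimately show ?L by blast
    qed
  qed
  show "(\<exists>S \<in> stars (Suc l). (\<forall>A\<in>?\<phi> D. S \<inter> A \<noteq> {}) \<and> (\<forall>A\<in>?\<phi> E. S \<inter> A \<noteq> {})) \<longleftrightarrow>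
      vec.dim (D \<inter> E) + 1 = Suc l" (is "?L \<longleftrightarrow> ?R")
    if "D \<in> ?D" "E \<in> ?D" "D \<noteq> E" for D E
  proof -
    have DE: "D \<in> subspaces_of_dim (Suc l)" "E \<in> subspaces_of_dim (Suc l)" using that by auto
    \<comment> \<open>\<open>D\<close> is the intersection of two of the \<open>Y\<close>, which gives one direction; the counting lemma gives
      the other.\<close>
    have meets: "(\<forall>A\<in>?\<phi> D. star_c (Suc l) X \<inter> A \<noteq> {}) \<longleftrightarrow> X \<subseteq> D"
      if X: "X \<in> subspaces_of_dim l" and D: "D \<in> subspaces_of_dim (Suc l)" for X D
    proof
      assume meet: "\<forall>A\<in>?\<phi> D. star_c (Suc l) X \<inter> A \<noteq> {}"
      have XY: "X \<subseteq> Y" if "Y \<in> star_c (Suc (Suc l)) D" for Y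
      proof -
        have "star_c (Suc l) X \<inter> top_c (Suc l) Y \<noteq> {}" by (rule bspec[OF meet imageI[OF that]])
        then obtain U where "U \<in> star_c (Suc l) X" "U \<in> top_c (Suc l) Y" by blast
        then show ?thesis by auto
      qed
      have "Suc (Suc (Suc l)) \<le> CARD('n)" using n by simp
      then obtain Q :: "('a ^ 'n) set" where Q: "Q \<in> subspaces_of_dim (Suc (Suc (Suc l)))"
        by (rule exists_superspace[OF zero_subspaces_of_dim le0])
      obtain Y where Y: "Y \<in> star_c (Suc (Suc l)) D"
        using star_c_not_within[OF D nl T(1,2) Q] by blast
      then have "Y \<in> subspaces_of_dim (Suc (Suc l))" by simp
      then obtain Q' where Q': "Q' \<in> subspaces_of_dim (Suc (Suc (Suc l)))" "Y \<subseteq> Q'"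
        by (rule exists_superspace[OF _ le_SucI[OF order_refl] \<open>Suc (Suc (Suc l)) \<le> CARD('n)\<close>])
      obtain Y' where Y': "Y' \<in> star_c (Suc (Suc l)) D" "\<not> Y' \<subseteq> Q'"
        using star_c_not_within[OF D nl T(1,2) Q'(1)] by blast
      have "Y \<inter> Y' = D"
        by (rule Int_eq_common_hyperplane[OF D]) (use Y Y' Q'(2) in auto)
      with XY[OF Y] XY[OF Y'(1)] show "X \<subseteq> D" by blast
    next
      assume "X \<subseteq> D"
      show "\<forall>A\<in>?\<phi> D. star_c (Suc l) X \<inter> A \<noteq> {}"
      proof
        fix A assume "A \<in> ?\<phi> D"
        then obtain Y where Y: "Y \<in> subspaces_of_dim (Suc (Suc l))" "D \<subseteq> Y" "\<not> degenerate Y"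
          "A = top_c (Suc l) Y" by auto
        obtain U where "U \<in> subspaces_of_dim (Suc l)" "X \<subseteq> U" "U \<subseteq> Y" "\<not> degenerate U"
          by (rule exists_nondegenerate_between[OF X Y(1) subset_trans[OF \<open>X \<subseteq> D\<close> Y(2)] Y(3) T(1,3)])
        then have "U \<in> star_c (Suc l) X \<inter> A" using Y(4) by simp
        then show "star_c (Suc l) X \<inter> A \<noteq> {}" by blast
      qed
    qed
    have "?L \<longleftrightarrow> (\<exists>X \<in> subspaces_of_dim l. X \<subseteq> D \<and> X \<subseteq> E)"
      unfolding stars_eq[OF n' T(1,2)] bex_simps
      by (rule bex_cong[OF refl]) (simp only: meets[OF _ DE(1)] meets[OF _ DE(2)])
    also have "\<dots> \<longleftrightarrow> ?R" by (rule exists_common_hyperplane_iff[OF DE that(3)])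
    finally show ?thesis .
  qed
qed

theorem theorem8:
  fixes k :: nat
  assumes "1 < k" and "k < CARD('n::finite) - 1"
    and "infinite (UNIV :: 'a::field set) \<or> CARD('a) > CARD('n) - k"
  shows "(k \<ge> 3 \<longrightarrow>
           (\<exists>f. is_graph_isomorphism (Gamma_s k) (Grassmann_graph k :: ('a ^ 'n) set sgraph) f \<and>
                (\<forall>U \<in> vertices (Delta k). f (Inl U) = U)))
       \<and> (k \<le> CARD('n) - 3 \<longrightarrow>
           (\<exists>f. is_graph_isomorphism (Gamma_t k) (Grassmann_graph k :: ('a ^ 'n) set sgraph) f \<and>
                (\<forall>U \<in> vertices (Delta k). f (Inl U) = U)))"
proof -
  \<comment> \<open>With \<open>l = k - 1\<close>, this is the smallest size that satisfies \<open>n \<le> l + q\<close>; it exceeds \<open>2\<close> because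
    \<open>k < n - 1\<close>.\<close>
  define q where "q = CARD('n) - k + 1"
  have "\<exists>T. T \<subseteq> (UNIV :: 'a set) \<and> finite T \<and> card T = q"
  proof (cases "finite (UNIV :: 'a set)")
    case True
    then have "q \<le> CARD('a)" using assms(3) by (simp add: q_def)
    then show ?thesis using obtain_subset_with_card_n by metis
  next
    case False
    then show ?thesis using infinite_arbitrarily_large by metis
  qed
  then obtain T :: "'a set" where T: "finite T" "card T = q" by blast
  obtain l where l: "k = Suc l" "0 < l" using \<open>1 < k\<close> by (cases k) auto
  have T': "2 < card T" "CARD('n) \<le> l + card T" and n: "l + 2 < CARD('n)"
    using assms(1,2) l T(2) by (auto simp: q_def)
  show ?thesis
  proof (intro conjI impI)
    assume "k \<ge> 3"
    then obtain j where "l = Suc j" "0 < j" using l by (cases l) auto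
    from Gamma_s_isomorphism[OF this n T(1) T'] show "\<exists>f. is_graph_isomorphism (Gamma_s k)
        (Grassmann_graph k :: ('a ^ 'n) set sgraph) f \<and> (\<forall>U \<in> vertices (Delta k). f (Inl U) = U)"
      unfolding l(1) .
  next
    assume "k \<le> CARD('n) - 3"
    then have "l + 3 < CARD('n)" using n l by simp
    from Gamma_t_isomorphism[OF l(2) this T(1) T'] show "\<exists>f. is_graph_isomorphism (Gamma_t k)
        (Grassmann_graph k :: ('a ^ 'n) set sgraph) f \<and> (\<forall>U \<in> vertices (Delta k). f (Inl U) = U)"
      unfolding l(1) .
  qed
qed

end
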